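(* If $X$ is a compact quasialgebraic set, then there is a cabled linkage $\mathcal L$ such that its configuration space $\mathcal C(\mathcal L)$ is analytically isomorphic to $X$. In fact there is a polynomial map from $\mathcal C(\mathcal L)$ to $X$ giving this isomorphism.
   Context: A cabled linkage is a quintuple $\mathcal L=(L,\ell,V,\mu,F)$, where $L$ is a finite graph with vertex set $\mathcal V(L)$ and edge set $\mathcal E(L)$, $\ell$ assigns a positive real number $\ell(\overline{vw})$ to each edge $\overline{vw}$, $V\subset\mathcal V(L)$ is a subset (the fixed vertices), $\mu\colon V\to\mathbb C$ is a map (telling where they are fixed), and $F\subset\mathcal E(L)$ is a subset (the flexible edges). Its configuration space is the set $\mathcal C(\mathcal L)$ of all maps $\varphi\colon\mathcal V(L)\to\mathbb C$ such that $\varphi(v)=\mu(v)$ for $v\in V$, $|\varphi(v)-\varphi(w)|\le\ell(\overline{vw})$ if $\overline{vw}\in F$, and $|\varphi(v)-\varphi(w)|=\ell(\overline{vw})$ if $\overline{vw}\in\mathcal E(L)-F$. Viewing $\mathbb C$ as $\mathbb R^2$, $\mathcal C(\mathcal L)$ is a subset of $\mathbb C^{\mathcal V(L)}=\mathbb R^{2|\mathcal V(L)|}$. A quasialgebraic set is a subset of some $\mathbb R^n$ of the form $\{x\in\mathbb R^n\mid p_i(x)=0,\ i=1,\ldots,k,\ \text{and } q_j(x)\ge 0,\ j=1,\ldots,m\}$ for some real polynomials $p_i$ and $q_j$. For $X\subset\mathbb R^n$ and $Y\subset\mathbb R^m$, a homeomorphism $f\colon X\to Y$ is an analytic isomorphism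 if $f$ and $f^{-1}$ are both restrictions of analytic maps, i.e., maps locally given by power series. *)

theory Defs
  imports "HOL-Analysis.Analysis" "HOL-Library.Poly_Mapping"
begin

text \<open>
  For a finite index set \<open>I\<close>, the space \<open>\<real>\<^sup>I\<close> is \<^term>\<open>powertop_real I\<close>; its points are the
  functions that are \<^const>\<open>undefined\<close> outside \<open>I\<close>. In particular \<open>\<real>\<^sup>n\<close> is
  \<^term>\<open>powertop_real {..<n::nat}\<close>, including \<open>n = 0\<close>.
\<close>

subsection \<open>Polynomials and power series in several variables\<close>

definition monom_at :: "('i \<Rightarrow>\<^sub>0 nat) \<Rightarrow> ('i \<Rightarrow> real) \<Rightarrow> real" where
  "monom_at m x = (\<Prod>i\<in>Poly_Mapping.keys m. x i ^ Poly_Mapping.lookup m i)"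

text \<open>A polynomial maps each of its finitely many monomials (exponent vectors) to its coefficient.\<close>

type_synonym 'i mpoly = "('i \<Rightarrow>\<^sub>0 nat) \<Rightarrow>\<^sub>0 real"

definition mpoly_vars :: "'i mpoly \<Rightarrow> 'i set" where
  "mpoly_vars p = (\<Union>m\<in>Poly_Mapping.keys p. Poly_Mapping.keys m)"

definition mpoly_eval :: "'i mpoly \<Rightarrow> ('i \<Rightarrow> real) \<Rightarrow> real" where
  "mpoly_eval p x = (\<Sum>m\<in>Poly_Mapping.keys p. Poly_Mapping.lookup p m * monom_at m x)"

definition polynomial_map ::
  "'i set \<Rightarrow> 'j set \<Rightarrow> (('i \<Rightarrow> real) \<Rightarrow> ('j \<Rightarrow> real)) \<Rightarrow> bool" where
  "polynomial_map I J f \<longleftrightarrow>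
     (\<exists>p :: 'j \<Rightarrow> 'i mpoly. (\<forall>j\<in>J. mpoly_vars (p j) \<subseteq> I) \<and>
        (\<forall>x \<in> topspace (powertop_real I). f x = (\<lambda>j\<in>J. mpoly_eval (p j) x)))"

definition analytic_fun :: "'i set \<Rightarrow> ('i \<Rightarrow> real) set \<Rightarrow> (('i \<Rightarrow> real) \<Rightarrow> real) \<Rightarrow> bool" where
  "analytic_fun I U f \<longleftrightarrow> openin (powertop_real I) U \<and>
     (\<forall>a\<in>U. \<exists>(c :: ('i \<Rightarrow>\<^sub>0 nat) \<Rightarrow> real) r. r > 0 \<and>
        (\<forall>x\<in>U. (\<forall>i\<in>I. \<bar>x i - a i\<bar> < r) \<longrightarrow>
           ((\<lambda>m. c m * monom_at m (\<lambda>i. x i - a i)) has_sum f x)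
             {m. Poly_Mapping.keys m \<subseteq> I}))"

definition analytic_map ::
  "'i set \<Rightarrow> ('i \<Rightarrow> real) set \<Rightarrow> 'j set \<Rightarrow> (('i \<Rightarrow> real) \<Rightarrow> ('j \<Rightarrow> real)) \<Rightarrow> bool" where
  "analytic_map I U J f \<longleftrightarrow> openin (powertop_real I) U \<and>
     f ` U \<subseteq> topspace (powertop_real J) \<and> (\<forall>j\<in>J. analytic_fun I U (\<lambda>x. f x j))"

definition restriction_of_analytic ::
  "'i set \<Rightarrow> ('i \<Rightarrow> real) set \<Rightarrow> 'j set \<Rightarrow> (('i \<Rightarrow> real) \<Rightarrow> ('j \<Rightarrow> real)) \<Rightarrow> bool" where
  "restriction_of_analytic I X J f \<longleftrightarrow>
     (\<exists>U F. X \<subseteq> U \<and> analytic_map I U J F \<and> (\<forall>x\<in>X. f x = F x))"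

definition analytic_isomorphism ::
  "'i set \<Rightarrow> ('i \<Rightarrow> real) set \<Rightarrow> 'j set \<Rightarrow> ('j \<Rightarrow> real) set
     \<Rightarrow> (('i \<Rightarrow> real) \<Rightarrow> ('j \<Rightarrow> real)) \<Rightarrow> bool" where
  "analytic_isomorphism I X J Y f \<longleftrightarrow>
     X \<subseteq> topspace (powertop_real I) \<and> Y \<subseteq> topspace (powertop_real J) \<and>
     (\<exists>g. homeomorphic_maps (subtopology (powertop_real I) X) (subtopology (powertop_real J) Y) f g \<and>
          restriction_of_analytic I X J f \<and> restriction_of_analytic J Y I g)"

definition quasialgebraic :: "'i set \<Rightarrow> ('i \<Rightarrow> real) set \<Rightarrow> bool" where
  "quasialgebraic I X \<longleftrightarrow>
     (\<exists>P Q :: 'i mpoly set. finite P \<and> finite Q \<and> (\<forall>p \<in> P \<union> Q. mpoly_vars p \<subseteq> I) \<and>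
        X = {x \<in> topspace (powertop_real I).
               (\<forall>p\<in>P. mpoly_eval p x = 0) \<and> (\<forall>q\<in>Q. mpoly_eval q x \<ge> 0)})"

subsection \<open>Cabled linkages\<close>

text \<open>
  Edges are two-element sets of vertices. The functions \<open>len\<close> and \<open>pos\<close> are relevant
  only on \<open>edges\<close> and \<open>fixed\<close>, respectively.
\<close>

record 'v linkage_data =
  verts :: "'v set"
  edges :: "'v set set"
  len :: "'v set \<Rightarrow> real"
  fixed :: "'v set"
  pos :: "'v \<Rightarrow> complex"
  flexible :: "'v set set"

definition cabled_linkage :: "'v linkage_data \<Rightarrow> bool" where
  "cabled_linkage L \<longleftrightarrow>
     finite (verts L) \<and>
     edges L \<subseteq> {{v, w} | v w. v \<in> verts L \<and> w \<in> verts L \<and> v \<noteq> w} \<and>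
     (\<forall>e\<in>edges L. len L e > 0) \<and>
     fixed L \<subseteq> verts L \<and>
     flexible L \<subseteq> edges L"

definition config_space :: "'v linkage_data \<Rightarrow> ('v \<Rightarrow> complex) set" where
  "config_space L = {\<phi> \<in> verts L \<rightarrow>\<^sub>E UNIV.
     (\<forall>v\<in>fixed L. \<phi> v = pos L v) \<and>
     (\<forall>v w. {v, w} \<in> flexible L \<longrightarrow> cmod (\<phi> v - \<phi> w) \<le> len L {v, w}) \<and>
     (\<forall>v w. {v, w} \<in> edges L - flexible L \<longrightarrow> cmod (\<phi> v - \<phi> w) = len L {v, w})}"

text \<open>
  The identification of \<open>\<complex>\<^sup>V\<close> with \<open>\<real>\<close>-space on the index set \<^term>\<open>V <+> V\<close>:
  \<^term>\<open>Inl v\<close> and \<^term>\<open>Inr v\<close> index the real and imaginary part at \<open>v\<close>.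
\<close>

definition real_coords :: "'v set \<Rightarrow> ('v \<Rightarrow> complex) \<Rightarrow> ('v + 'v \<Rightarrow> real)" where
  "real_coords V \<phi> = restrict (case_sum (\<lambda>v. Re (\<phi> v)) (\<lambda>v. Im (\<phi> v))) (V <+> V)"

end

(*
  All constructions are local. A linkage is described by germs at 0 of functions of finitely many
  complex inputs z, one function per vertex; cabling every vertex to its position at z = 0 by a short
  cable leaves no freedom but z, because two rods determine the position of a new vertex up to a
  reflection, which the cable excludes. Peaucellier's inversor and parallelograms then compute
  sums, real multiples, squares and hence all polynomials of the inputs. Rods and cables at the end
  force the inputs to be real (inversion turns a line into a circle) and the polynomials defining X
  to be nonnegative. Compactness enters by scaling X into the small domain: the linkage computes
  homogenized polynomials, and the homogenizing input is fixed at the scale eps. Every vertex is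
  an analytic function of x because only rational operations and square roots of positive
  quantities occur.
*)

theory Submission
  imports Defs
begin

subsection \<open>Power series in several variables\<close>

text \<open>The order in which constants are chosen shapes the proof. The cable length must lie
  below a uniqueness radius that depends on the whole linkage, and only then may \<open>X\<close> be
  scaled until no vertex reaches the end of the cable to its base position. Computing a polynomial
  at \<open>x / \<epsilon>\<close> directly would put \<open>\<epsilon>\<close> into the
  coefficients, hence into the linkage and its uniqueness radius, which is circular. With the scale
  as one more input, the linkage is complete before \<open>\<epsilon>\<close> is known. Excluding
  reflections has a price: the two rods that place a vertex must not be collinear at z = 0. The
  computed quantities are all real there, so gadgets have to leave the real axis, and every constant
  in them is chosen to avoid a flat position. The isomorphism needs no inverse function theorem. In
  one direction it reads off the input vertices and rescales them, which is linear; in the other it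
  is the parametrization by the inputs, which is analytic on an open box around \<open>X\<close> and
  not only on \<open>X\<close>.\<close>

abbreviation mons :: "'i set \<Rightarrow> ('i \<Rightarrow>\<^sub>0 nat) set" where
  "mons I \<equiv> {m. Poly_Mapping.keys m \<subseteq> I}"

lemma monom_at_superset:
  assumes "finite I" "m \<in> mons I"
  shows "monom_at m x = (\<Prod>i\<in>I. x i ^ Poly_Mapping.lookup m i)"
  unfolding monom_at_def
  by (rule prod.mono_neutral_left) (use assms in \<open>auto simp: in_keys_iff\<close>)

lemma monom_at_0 [simp]: "monom_at 0 x = 1"
  by (simp add: monom_at_def)

lemma monom_at_add: "monom_at (m + m') x = monom_at m x * monom_at m' x"
proof -
  let ?I = "Poly_Mapping.keys m \<union> Poly_Mapping.keys m'"
  have "Poly_Mapping.keys (m + m') \<subseteq> ?I"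
    by (rule keys_add)
  then show ?thesis
    by (simp add: monom_at_superset[of ?I] lookup_add power_add prod.distrib)
qed

lemma monom_at_single: "monom_at (Poly_Mapping.single i 1) x = x i"
  by (simp add: monom_at_def)

lemma monom_at_abs_le:
  assumes "m \<in> mons I" "\<forall>i\<in>I. \<bar>y i\<bar> \<le> \<rho>"
  shows "\<bar>monom_at m y\<bar> \<le> monom_at m (\<lambda>_. \<rho>)"
  unfolding monom_at_def abs_prod
  by (rule prod_mono) (use assms in \<open>auto simp: power_abs intro!: power_mono\<close>)

lemma monom_at_pos: "\<rho> > 0 \<Longrightarrow> monom_at m (\<lambda>_. \<rho>) > 0"
  unfolding monom_at_def by (auto intro!: prod_pos)

lemma monom_at_nonneg: "\<rho> \<ge> 0 \<Longrightarrow> monom_at m (\<lambda>_. \<rho>) \<ge> 0"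
  unfolding monom_at_def by (auto intro!: prod_nonneg)

text \<open>One factor \<open>t\<close> comes from a variable occurring in \<open>m\<close>; the
  other powers of \<open>t\<close> are at most 1. So when the radius shrinks by \<open>t\<close>,
  every term but the constant one shrinks at least as fast.\<close>

lemma monom_at_scale_le:
  fixes t \<rho> :: real
  assumes "m \<noteq> 0" "0 \<le> t" "t \<le> 1" "\<rho> \<ge> 0"
  shows "monom_at m (\<lambda>_. t * \<rho>) \<le> t * monom_at m (\<lambda>_. \<rho>)"
proof -
  obtain i where i: "i \<in> Poly_Mapping.keys m"
    using assms(1) by (meson all_not_in_conv keys_eq_empty)
  have "(\<Prod>i\<in>Poly_Mapping.keys m. t ^ Poly_Mapping.lookup m i)
      = t ^ Poly_Mapping.lookup m i * (\<Prod>i\<in>Poly_Mapping.keys m - {i}. t ^ Poly_Mapping.lookup m i)"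
    using i by (simp add: prod.remove)
  also have "\<dots> \<le> t * 1"
  proof (rule mult_mono)
    have "t ^ Poly_Mapping.lookup m i \<le> t ^ 1"
      by (rule power_decreasing) (use i assms in \<open>auto simp: in_keys_iff\<close>)
    then show "t ^ Poly_Mapping.lookup m i \<le> t" by simp
    show "(\<Prod>i\<in>Poly_Mapping.keys m - {i}. t ^ Poly_Mapping.lookup m i) \<le> 1"
      by (rule prod_le_1) (use assms in \<open>auto intro: power_le_one\<close>)
  qed (use assms in \<open>auto intro!: prod_nonneg\<close>)
  finally have *: "(\<Prod>i\<in>Poly_Mapping.keys m. t ^ Poly_Mapping.lookup m i) \<le> t" by simp
  have "monom_at m (\<lambda>_. t * \<rho>) = (\<Prod>i\<in>Poly_Mapping.keys m. t ^ Poly_Mapping.lookup m i) * monom_at m (\<lambda>_. \<rho>)"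
    by (simp add: monom_at_def power_mult_distrib prod.distrib)
  also have "\<dots> \<le> t * monom_at m (\<lambda>_. \<rho>)"
    using * monom_at_nonneg[OF assms(4)] by (intro mult_right_mono) auto
  finally show ?thesis .
qed

text \<open>A weighted l1 norm of the coefficients, submultiplicative for products of series. Only
  an upper bound is recorded, so that operations on series become operations on bounds.\<close>

definition majorized :: "'i set \<Rightarrow> real \<Rightarrow> (('i \<Rightarrow>\<^sub>0 nat) \<Rightarrow> real) \<Rightarrow> real \<Rightarrow> bool" where
  "majorized I \<rho> c B \<longleftrightarrow>
     (\<exists>B'\<le>B. ((\<lambda>m. \<bar>c m\<bar> * monom_at m (\<lambda>_. \<rho>)) has_sum B') (mons I))"

definition represents ::
  "'i set \<Rightarrow> ('i \<Rightarrow> real) set \<Rightarrow> ('i \<Rightarrow> real) \<Rightarrow> real \<Rightarrow> (('i \<Rightarrow>\<^sub>0 nat) \<Rightarrow> real) \<Rightarrow> (('i \<Rightarrow> real) \<Rightarrow> real) \<Rightarrow> bool" where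
  "represents I U a \<rho> c f \<longleftrightarrow>
     (\<forall>x\<in>U. (\<forall>i\<in>I. \<bar>x i - a i\<bar> \<le> \<rho>) \<longrightarrow>
        ((\<lambda>m. c m * monom_at m (\<lambda>i. x i - a i)) has_sum f x) (mons I))"

definition series_at ::
  "'i set \<Rightarrow> ('i \<Rightarrow> real) set \<Rightarrow> ('i \<Rightarrow> real) \<Rightarrow> (('i \<Rightarrow> real) \<Rightarrow> real) \<Rightarrow> real \<Rightarrow> real \<Rightarrow> bool" where
  "series_at I U a f \<rho> B \<longleftrightarrow> \<rho> > 0 \<and> (\<exists>c. majorized I \<rho> c B \<and> represents I U a \<rho> c f)"

text \<open>Products and compositions yield families in which one monomial occurs many times. Adding
  the coefficients over each fibre of \<open>\<mu>\<close> gives a genuine power series, and the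
  triangle inequality preserves the majorant. The coefficients are fixed before \<open>y\<close>, so
  one series serves all points.\<close>

lemma collapse_series:
  fixes d :: "'s \<Rightarrow> real" and \<mu> :: "'s \<Rightarrow> ('i \<Rightarrow>\<^sub>0 nat)"
  assumes \<rho>: "\<rho> > 0" and \<mu>: "\<mu> ` S \<subseteq> mons I"
    and B: "((\<lambda>s. \<bar>d s\<bar> * monom_at (\<mu> s) (\<lambda>_. \<rho>)) has_sum B) S"
  obtains c where "majorized I \<rho> c B"
    "\<And>y F. ((\<lambda>s. d s * monom_at (\<mu> s) y) has_sum F) S \<Longrightarrow> ((\<lambda>m. c m * monom_at m y) has_sum F) (mons I)"
proof -
  define A where "A m = {s \<in> S. \<mu> s = m}" for m
  define w where "w m = monom_at m (\<lambda>_::'i. \<rho>)" for m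
  have w: "w m > 0" for m
    using monom_at_pos[OF \<rho>] by (simp add: w_def)
  have sm: "(\<lambda>s. \<bar>d s\<bar>) summable_on A m" for m
  proof -
    have "(\<lambda>s. \<bar>d s\<bar> * w (\<mu> s)) summable_on A m"
      unfolding w_def by (rule summable_on_subset_banach[OF has_sum_imp_summable[OF B]]) (auto simp: A_def)
    then have "(\<lambda>s. \<bar>d s\<bar> * w m) summable_on A m"
      by (rule summable_on_cong[THEN iffD1, rotated]) (simp add: A_def)
    then have "(\<lambda>s. \<bar>d s\<bar> * w m * (1 / w m)) summable_on A m"
      by (rule summable_on_cmult_left)
    then show ?thesis using w[of m] by simp
  qed
  have sm': "d summable_on A m" for m
    by (subst summable_on_iff_abs_summable_on_real) (simp only: real_norm_def sm)
  have bij: "bij_betw snd (Sigma (mons I) A) S"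
    by (rule bij_betwI[where g="\<lambda>s. (\<mu> s, s)"]) (use \<mu> in \<open>auto simp: A_def\<close>)
  \<comment> \<open>The fibres \<open>A m\<close> partition \<open>S\<close>, so a sum over
    \<open>S\<close> may be taken fibre by fibre.\<close>
  have fib: "((\<lambda>m. b m) has_sum F) (mons I)"
    if "(g has_sum F) S" "\<And>m. (g has_sum b m) (A m)" for g :: "'s \<Rightarrow> real" and F b
  proof (rule has_sum_SigmaD)
    show "((\<lambda>x. g (snd x)) has_sum F) (Sigma (mons I) A)"
      using that(1) has_sum_reindex_bij_betw[OF bij, of g F] by simp
  qed (use that in auto)
  define c where "c m = infsum d (A m)" for m
  show ?thesis
  proof (rule that[of c])
    have e: "((\<lambda>m. infsum (\<lambda>s. \<bar>d s\<bar>) (A m) * w m) has_sum B) (mons I)"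
    proof (rule fib[OF B])
      fix m
      have "((\<lambda>s. \<bar>d s\<bar> * w m) has_sum infsum (\<lambda>s. \<bar>d s\<bar>) (A m) * w m) (A m)"
        by (rule has_sum_cmult_left) (use sm in auto)
      then show "((\<lambda>s. \<bar>d s\<bar> * monom_at (\<mu> s) (\<lambda>_. \<rho>)) has_sum infsum (\<lambda>s. \<bar>d s\<bar>) (A m) * w m) (A m)"
        by (rule has_sum_cong[THEN iffD1, rotated]) (simp add: A_def w_def)
    qed
    have le: "\<bar>c m\<bar> * w m \<le> infsum (\<lambda>s. \<bar>d s\<bar>) (A m) * w m" for m
    proof -
      have "norm (c m) \<le> infsum (\<lambda>s. norm (d s)) (A m)"
        unfolding c_def by (rule norm_infsum_bound) (use sm in auto)
      then show ?thesis using w[of m] by (intro mult_right_mono) auto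
    qed
    have "(\<lambda>m. \<bar>c m\<bar> * w m) summable_on mons I"
      by (rule summable_on_comparison_test[OF has_sum_imp_summable[OF e]])
        (use le w[THEN less_imp_le] in \<open>auto intro!: mult_nonneg_nonneg\<close>)
    then have "((\<lambda>m. \<bar>c m\<bar> * w m) has_sum infsum (\<lambda>m. \<bar>c m\<bar> * w m) (mons I)) (mons I)"
      by simp
    moreover from has_sum_mono[OF this e] have "infsum (\<lambda>m. \<bar>c m\<bar> * w m) (mons I) \<le> B"
      using le by auto
    ultimately show "majorized I \<rho> c B"
      unfolding majorized_def w_def by blast
  next
    fix y F assume F: "((\<lambda>s. d s * monom_at (\<mu> s) y) has_sum F) S"
    show "((\<lambda>m. c m * monom_at m y) has_sum F) (mons I)"
    proof (rule fib[OF F])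
      fix m
      have "((\<lambda>s. d s * monom_at m y) has_sum c m * monom_at m y) (A m)"
        unfolding c_def by (rule has_sum_cmult_left) (use sm' in auto)
      then show "((\<lambda>s. d s * monom_at (\<mu> s) y) has_sum c m * monom_at m y) (A m)"
        by (rule has_sum_cong[THEN iffD1, rotated]) (simp add: A_def)
    qed
  qed
qed

lemma series_atI:
  fixes d :: "'s \<Rightarrow> real" and \<mu> :: "'s \<Rightarrow> ('i \<Rightarrow>\<^sub>0 nat)"
  assumes "\<rho> > 0" "\<mu> ` S \<subseteq> mons I"
    and "((\<lambda>s. \<bar>d s\<bar> * monom_at (\<mu> s) (\<lambda>_. \<rho>)) has_sum B') S" "B' \<le> B"
    and "\<And>x. x \<in> U \<Longrightarrow> \<forall>i\<in>I. \<bar>x i - a i\<bar> \<le> \<rho> \<Longrightarrow>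
           ((\<lambda>s. d s * monom_at (\<mu> s) (\<lambda>i. x i - a i)) has_sum f x) S"
  shows "series_at I U a f \<rho> B"
proof -
  obtain c where c: "majorized I \<rho> c B'"
    "\<And>y F. ((\<lambda>s. d s * monom_at (\<mu> s) y) has_sum F) S \<Longrightarrow> ((\<lambda>m. c m * monom_at m y) has_sum F) (mons I)"
    using collapse_series[OF assms(1-3)] by blast
  have "majorized I \<rho> c B"
    using c(1) assms(4) unfolding majorized_def by (meson order_trans)
  moreover have "represents I U a \<rho> c f"
    unfolding represents_def
  proof (intro ballI impI)
    fix x assume "x \<in> U" "\<forall>i\<in>I. \<bar>x i - a i\<bar> \<le> \<rho>"
    then show "((\<lambda>m. c m * monom_at m (\<lambda>i. x i - a i)) has_sum f x) (mons I)"
      by (intro c(2) assms(5))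
  qed
  ultimately show ?thesis
    unfolding series_at_def using assms(1) by blast
qed

lemma series_at_const: "\<rho> > 0 \<Longrightarrow> series_at I U a (\<lambda>_. v) \<rho> \<bar>v\<bar>"
  by (rule series_atI[where S="{()}" and \<mu>="\<lambda>_. 0" and d="\<lambda>_. v"])
    (auto intro!: has_sum_finiteI)

lemma series_at_coord: "\<rho> > 0 \<Longrightarrow> i \<in> I \<Longrightarrow> series_at I U a (\<lambda>x. x i - a i) \<rho> \<rho>"
  by (rule series_atI[where S="{()}" and \<mu>="\<lambda>_. Poly_Mapping.single i 1" and d="\<lambda>_. 1"])
    (auto intro!: has_sum_finiteI simp: monom_at_single[unfolded One_nat_def])

lemma series_at_add:
  assumes "series_at I U a f \<rho> B" "series_at I U a g \<rho> C"
  shows "series_at I U a (\<lambda>x. f x + g x) \<rho> (B + C)"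
proof -
  obtain c B' where c: "B' \<le> B" "((\<lambda>m. \<bar>c m\<bar> * monom_at m (\<lambda>_. \<rho>)) has_sum B') (mons I)"
      "represents I U a \<rho> c f" "\<rho> > 0"
    using assms(1) unfolding series_at_def majorized_def by blast
  obtain d C' where d: "C' \<le> C" "((\<lambda>m. \<bar>d m\<bar> * monom_at m (\<lambda>_. \<rho>)) has_sum C') (mons I)"
      "represents I U a \<rho> d g"
    using assms(2) unfolding series_at_def majorized_def by blast
  have sum: "((\<lambda>m. \<bar>c m\<bar> * monom_at m (\<lambda>_. \<rho>) + \<bar>d m\<bar> * monom_at m (\<lambda>_. \<rho>)) has_sum B' + C') (mons I)"
    by (rule has_sum_add[OF c(2) d(2)])
  have le: "\<bar>c m + d m\<bar> * monom_at m (\<lambda>_. \<rho>) \<le> \<bar>c m\<bar> * monom_at m (\<lambda>_. \<rho>) + \<bar>d m\<bar> * monom_at m (\<lambda>_. \<rho>)" for m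
    using monom_at_nonneg[of \<rho> m] c(4) by (simp flip: distrib_right add: mult_right_mono)
  have "(\<lambda>m. \<bar>c m + d m\<bar> * monom_at m (\<lambda>_. \<rho>)) summable_on mons I"
    by (rule summable_on_comparison_test[OF has_sum_imp_summable[OF sum]])
      (use le c(4) in \<open>auto intro!: mult_nonneg_nonneg monom_at_nonneg\<close>)
  then obtain E where E: "((\<lambda>m. \<bar>c m + d m\<bar> * monom_at m (\<lambda>_. \<rho>)) has_sum E) (mons I)"
    unfolding summable_on_def by blast
  have "E \<le> B' + C'"
    by (rule has_sum_mono[OF E sum]) (use le in auto)
  then have "majorized I \<rho> (\<lambda>m. c m + d m) (B + C)"
    unfolding majorized_def using E c(1) d(1) by (intro exI[of _ E]) auto
  moreover have "represents I U a \<rho> (\<lambda>m. c m + d m) (\<lambda>x. f x + g x)"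
    using c(3) d(3) unfolding represents_def by (auto simp: distrib_right intro!: has_sum_add)
  ultimately show ?thesis
    unfolding series_at_def using c(4) by blast
qed

text \<open>Over the reals \<open>has_sum\<close> is unconditional, hence absolute; this supplies
  the summability on the product that the exchange of sums requires.\<close>

lemma has_sum_product_real:
  fixes f :: "'a \<Rightarrow> real" and g :: "'b \<Rightarrow> real"
  assumes "(f has_sum F) A" "(g has_sum G) B"
  shows "((\<lambda>(x, y). f x * g y) has_sum F * G) (A \<times> B)"
proof (rule has_sum_SigmaI)
  show "((\<lambda>y. (case (x, y) of (x, y) \<Rightarrow> f x * g y)) has_sum f x * G) B" for x
    using has_sum_cmult_right[OF assms(2)] by simp
  show "((\<lambda>x. f x * G) has_sum F * G) A"
    by (rule has_sum_cmult_left[OF assms(1)])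
  have f: "(\<lambda>x. norm (f x)) summable_on A" and g: "(\<lambda>x. norm (g x)) summable_on B"
    using assms summable_on_iff_abs_summable_on_real has_sum_imp_summable by metis+
  have "(\<lambda>s. norm (case s of (x, y) \<Rightarrow> f x * g y)) summable_on A \<times> B"
  proof (rule summable_on_SigmaI)
    show "((\<lambda>y. norm (case (x, y) of (x, y) \<Rightarrow> f x * g y)) has_sum norm (f x) * infsum (\<lambda>x. norm (g x)) B) B" for x
      using has_sum_cmult_right[OF has_sum_infsum[OF g], of "norm (f x)"] by (simp add: abs_mult)
    show "(\<lambda>x. norm (f x) * infsum (\<lambda>x. norm (g x)) B) summable_on A"
      by (rule summable_on_cmult_left[OF f])
  qed auto
  then show "(\<lambda>(x, y). f x * g y) summable_on A \<times> B"
    using summable_on_iff_abs_summable_on_real by blast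
qed

text \<open>The Cauchy product, indexed by pairs of exponents and then collapsed.\<close>

lemma series_at_mult:
  assumes "series_at I U a f \<rho> B" "series_at I U a g \<rho> C" "B \<ge> 0"
  shows "series_at I U a (\<lambda>x. f x * g x) \<rho> (B * C)"
proof -
  obtain c B' where c: "B' \<le> B" "((\<lambda>m. \<bar>c m\<bar> * monom_at m (\<lambda>_. \<rho>)) has_sum B') (mons I)"
      "represents I U a \<rho> c f" "\<rho> > 0"
    using assms(1) unfolding series_at_def majorized_def by blast
  obtain d C' where d: "C' \<le> C" "((\<lambda>m. \<bar>d m\<bar> * monom_at m (\<lambda>_. \<rho>)) has_sum C') (mons I)"
      "represents I U a \<rho> d g"
    using assms(2) unfolding series_at_def majorized_def by blast
  show ?thesis
  proof (rule series_atI[where S="mons I \<times> mons I" and \<mu>="\<lambda>(m, m'). m + m'" and d="\<lambda>(m, m'). c m * d m'"])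
    show "((\<lambda>s. \<bar>case s of (m, m') \<Rightarrow> c m * d m'\<bar> * monom_at (case s of (m, m') \<Rightarrow> m + m') (\<lambda>_. \<rho>)) has_sum B' * C')
        (mons I \<times> mons I)"
      using has_sum_product_real[OF c(2) d(2)]
      by (rule has_sum_cong[THEN iffD1, rotated]) (auto simp: monom_at_add abs_mult)
    have "C' \<ge> 0"
      by (rule has_sum_nonneg[OF d(2)]) (use c(4) in \<open>auto intro!: mult_nonneg_nonneg monom_at_nonneg\<close>)
    then show "B' * C' \<le> B * C"
      using c(1) d(1) assms(3) by (intro mult_mono) auto
    fix x assume x: "x \<in> U" "\<forall>i\<in>I. \<bar>x i - a i\<bar> \<le> \<rho>"
    have "((\<lambda>m. c m * monom_at m (\<lambda>i. x i - a i)) has_sum f x) (mons I)"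
      "((\<lambda>m. d m * monom_at m (\<lambda>i. x i - a i)) has_sum g x) (mons I)"
      using x c(3) d(3) unfolding represents_def by auto
    from has_sum_product_real[OF this]
    show "((\<lambda>s. (case s of (m, m') \<Rightarrow> c m * d m') * monom_at (case s of (m, m') \<Rightarrow> m + m') (\<lambda>i. x i - a i))
        has_sum f x * g x) (mons I \<times> mons I)"
      by (rule has_sum_cong[THEN iffD1, rotated]) (auto simp: monom_at_add)
  qed (use c(4) keys_add in \<open>auto dest!: keys_add[THEN subsetD]\<close>)
qed

lemma series_at_power:
  assumes "series_at I U a f \<rho> B" "B \<ge> 0"
  shows "series_at I U a (\<lambda>x. f x ^ k) \<rho> (B ^ k)"
proof (induction k)
  case 0
  have "\<rho> > 0" using assms(1) by (simp add: series_at_def)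
  then show ?case using series_at_const[of \<rho> I U a 1] by simp
next
  case (Suc k)
  then show ?case using series_at_mult[OF assms(1) Suc assms(2)] by simp
qed

lemma series_at_bound:
  assumes "series_at I U a f \<rho> B" "x \<in> U" "\<forall>i\<in>I. \<bar>x i - a i\<bar> \<le> \<rho>"
  shows "\<bar>f x\<bar> \<le> B"
proof -
  obtain c B' where c: "B' \<le> B" "((\<lambda>m. \<bar>c m\<bar> * monom_at m (\<lambda>_. \<rho>)) has_sum B') (mons I)"
      "represents I U a \<rho> c f" "\<rho> > 0"
    using assms(1) unfolding series_at_def majorized_def by blast
  have s: "((\<lambda>m. c m * monom_at m (\<lambda>i. x i - a i)) has_sum f x) (mons I)"
    using c(3) assms(2,3) by (auto simp: represents_def)
  have "norm (f x) \<le> B'"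
  proof (rule norm_infsum_le[OF s c(2)])
    fix m assume "m \<in> mons I"
    then show "norm (c m * monom_at m (\<lambda>i. x i - a i)) \<le> \<bar>c m\<bar> * monom_at m (\<lambda>_. \<rho>)"
      using monom_at_abs_le[of m I "\<lambda>i. x i - a i" \<rho>] assms(3) by (auto simp: abs_mult intro!: mult_left_mono)
  qed
  then show ?thesis using c(1) by simp
qed

text \<open>The expansions of all powers \<open>f x ^ k\<close> are merged into one family over
  pairs \<open>(k, m)\<close>. It is absolutely summable because \<open>B ^ k\<close> majorizes the
  power \<open>k\<close> and the outer series converges absolutely at \<open>B\<close>.\<close>

lemma series_at_compose:
  assumes f: "series_at I U a f \<rho> B" and "B \<ge> 0"
    and e: "summable (\<lambda>k. \<bar>e k\<bar> * B ^ k)"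
    and F: "\<And>x. x \<in> U \<Longrightarrow> \<forall>i\<in>I. \<bar>x i - a i\<bar> \<le> \<rho> \<Longrightarrow> (\<lambda>k. e k * f x ^ k) sums F x"
  shows "\<exists>C. series_at I U a F \<rho> C"
proof -
  have \<rho>: "\<rho> > 0" using f by (simp add: series_at_def)
  have "\<forall>k. \<exists>c. majorized I \<rho> c (B ^ k) \<and> represents I U a \<rho> c (\<lambda>x. f x ^ k)"
    using series_at_power[OF f \<open>B \<ge> 0\<close>] unfolding series_at_def by blast
  from choice[OF this] obtain c where c: "\<And>k. majorized I \<rho> (c k) (B ^ k)"
      "\<And>k. represents I U a \<rho> (c k) (\<lambda>x. f x ^ k)"
    by blast
  from c(1) have "\<forall>k. \<exists>B'. B' \<le> B ^ k \<and> ((\<lambda>m. \<bar>c k m\<bar> * monom_at m (\<lambda>_. \<rho>)) has_sum B') (mons I)"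
    unfolding majorized_def by blast
  from choice[OF this] obtain b where b: "\<And>k. b k \<le> B ^ k"
      "\<And>k. ((\<lambda>m. \<bar>c k m\<bar> * monom_at m (\<lambda>_. \<rho>)) has_sum b k) (mons I)"
    by blast
  have b0: "b k \<ge> 0" for k
    by (rule has_sum_nonneg[OF b(2)]) (use \<rho> in \<open>auto intro!: mult_nonneg_nonneg monom_at_nonneg\<close>)
  let ?S = "(UNIV :: nat set) \<times> mons I"
  let ?d = "\<lambda>(k, m). e k * c k m"
  have eB: "(\<lambda>k. \<bar>e k\<bar> * B ^ k) summable_on UNIV"
    using e \<open>B \<ge> 0\<close> by (intro norm_summable_imp_summable_on) simp
  have sm: "(\<lambda>s. \<bar>?d s\<bar> * monom_at (snd s) (\<lambda>_. \<rho>)) summable_on ?S"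
  proof (rule summable_on_SigmaI)
    show "((\<lambda>m. \<bar>?d (k, m)\<bar> * monom_at (snd (k, m)) (\<lambda>_. \<rho>)) has_sum \<bar>e k\<bar> * b k) (mons I)" for k
      using has_sum_cmult_right[OF b(2)[of k], of "\<bar>e k\<bar>"] by (simp add: abs_mult mult.assoc)
    show "(\<lambda>k. \<bar>e k\<bar> * b k) summable_on UNIV"
      by (rule summable_on_comparison_test[OF eB]) (use b(1) b0 in \<open>auto intro!: mult_left_mono\<close>)
  qed (use \<rho> in \<open>auto intro!: mult_nonneg_nonneg monom_at_nonneg\<close>)
  then obtain C where C: "((\<lambda>s. \<bar>?d s\<bar> * monom_at (snd s) (\<lambda>_. \<rho>)) has_sum C) ?S"
    unfolding summable_on_def by blast
  have "series_at I U a F \<rho> C"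
  proof (rule series_atI[OF \<rho> _ C order_refl])
    fix x assume x: "x \<in> U" "\<forall>i\<in>I. \<bar>x i - a i\<bar> \<le> \<rho>"
    show "((\<lambda>s. ?d s * monom_at (snd s) (\<lambda>i. x i - a i)) has_sum F x) ?S"
    proof (rule has_sum_SigmaI)
      have "((\<lambda>m. c k m * monom_at m (\<lambda>i. x i - a i)) has_sum f x ^ k) (mons I)" for k
        using c(2) x unfolding represents_def by blast
      from has_sum_cmult_right[OF this]
      show "((\<lambda>m. ?d (k, m) * monom_at (snd (k, m)) (\<lambda>i. x i - a i)) has_sum e k * f x ^ k) (mons I)" for k
        by (simp add: mult.assoc)
      have "summable (\<lambda>k. norm (e k * f x ^ k))"
      proof (rule summable_comparison_test'[OF e])
        show "norm (norm (e k * f x ^ k)) \<le> \<bar>e k\<bar> * B ^ k" for k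
          using series_at_bound[OF f x] by (auto simp: abs_mult power_abs intro!: mult_left_mono power_mono)
      qed
      then show "((\<lambda>k. e k * f x ^ k) has_sum F x) UNIV"
        by (rule norm_summable_imp_has_sum[OF _ F[OF x]])
      have "(\<lambda>s. norm (?d s * monom_at (snd s) (\<lambda>i. x i - a i))) summable_on ?S"
      proof (rule summable_on_comparison_test[OF sm])
        fix s assume "s \<in> ?S"
        then show "norm (?d s * monom_at (snd s) (\<lambda>i. x i - a i)) \<le> \<bar>?d s\<bar> * monom_at (snd s) (\<lambda>_. \<rho>)"
          using monom_at_abs_le[of "snd s" I "\<lambda>i. x i - a i" \<rho>] x(2)
          by (auto simp: abs_mult intro!: mult_left_mono)
      qed auto
      then show "(\<lambda>s. ?d s * monom_at (snd s) (\<lambda>i. x i - a i)) summable_on ?S"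
        using summable_on_iff_abs_summable_on_real by blast
    qed
  qed auto
  then show ?thesis by blast
qed

lemma series_at_center:
  assumes "represents I U a \<rho> c f" "a \<in> U" "\<rho> > 0"
  shows "c 0 = f a"
proof -
  have z: "monom_at m (\<lambda>i. a i - a i) = 0" if "m \<noteq> 0" for m
  proof -
    obtain i where i: "i \<in> Poly_Mapping.keys m"
      using \<open>m \<noteq> 0\<close> by (meson all_not_in_conv keys_eq_empty)
    have "\<exists>i\<in>Poly_Mapping.keys m. (0::real) ^ Poly_Mapping.lookup m i = 0"
      using i by (intro bexI[of _ i]) (auto simp: in_keys_iff)
    then show ?thesis unfolding monom_at_def by (simp add: prod_zero_iff)
  qed
  have "((\<lambda>m. c m * monom_at m (\<lambda>i. a i - a i)) has_sum f a) (mons I)"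
    using assms unfolding represents_def by auto
  moreover have "((\<lambda>m. c m * monom_at m (\<lambda>i. a i - a i)) has_sum c 0) (mons I)"
    by (rule has_sum_finite_neutralI[of "{0}"]) (use z in auto)
  ultimately show ?thesis using has_sum_unique by blast
qed

text \<open>Vanishing at the center removes the constant term, and each remaining monomial gains a
  factor \<open>t\<close>. The majorant thus becomes as small as desired, which substitution into a
  series of finite radius requires.\<close>

lemma series_at_shrink:
  assumes f: "series_at I U a f \<rho> B" and a: "a \<in> U" "f a = 0" and t: "0 < t" "t \<le> 1"
  shows "series_at I U a f (t * \<rho>) (t * B)"
proof -
  obtain c B' where c: "B' \<le> B" "((\<lambda>m. \<bar>c m\<bar> * monom_at m (\<lambda>_. \<rho>)) has_sum B') (mons I)"
      "represents I U a \<rho> c f" "\<rho> > 0"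
    using f unfolding series_at_def majorized_def by blast
  have c0: "c 0 = 0" using series_at_center[OF c(3) a(1) c(4)] a(2) by simp
  have le: "\<bar>c m\<bar> * monom_at m (\<lambda>_. t * \<rho>) \<le> t * (\<bar>c m\<bar> * monom_at m (\<lambda>_. \<rho>))" for m
  proof (cases "m = 0")
    case False
    then show ?thesis
      using mult_left_mono[OF monom_at_scale_le[OF False, of t \<rho>], of "\<bar>c m\<bar>"] t c(4)
      by (simp add: mult_ac)
  qed (use c0 in auto)
  have tB: "((\<lambda>m. t * (\<bar>c m\<bar> * monom_at m (\<lambda>_. \<rho>))) has_sum t * B') (mons I)"
    by (rule has_sum_cmult_right[OF c(2)])
  have "(\<lambda>m. \<bar>c m\<bar> * monom_at m (\<lambda>_. t * \<rho>)) summable_on mons I"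
    by (rule summable_on_comparison_test[OF has_sum_imp_summable[OF tB]])
      (use le t c(4) in \<open>auto intro!: mult_nonneg_nonneg monom_at_nonneg\<close>)
  then obtain E where E: "((\<lambda>m. \<bar>c m\<bar> * monom_at m (\<lambda>_. t * \<rho>)) has_sum E) (mons I)"
    unfolding summable_on_def by blast
  have "E \<le> t * B'"
    by (rule has_sum_mono[OF E tB]) (use le in auto)
  moreover have "t * B' \<le> t * B" using c(1) t by simp
  ultimately have "majorized I (t * \<rho>) c (t * B)"
    unfolding majorized_def using E by (intro exI[of _ E]) auto
  moreover have "represents I U a (t * \<rho>) c f"
  proof -
    have "t * \<rho> \<le> \<rho>" using t c(4) by (simp add: mult_le_cancel_right1)
    then show ?thesis using c(3) unfolding represents_def by (meson order_trans)
  qed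
  ultimately show ?thesis
    unfolding series_at_def using t c(4) by auto
qed

text \<open>Obtained by shrinking \<open>f - f a\<close> and adding the constant back. It brings two
  expansions at \<open>a\<close> to a common radius and makes the bound nonnegative, as
  \<open>series_at_mult\<close> demands.\<close>

lemma series_at_radius:
  assumes f: "series_at I U a f \<rho> B" and a: "a \<in> U" and "0 < \<rho>'" "\<rho>' \<le> \<rho>"
  shows "\<exists>B'\<ge>0. series_at I U a f \<rho>' B'"
proof -
  have \<rho>: "\<rho> > 0" using f by (simp add: series_at_def)
  have "series_at I U a (\<lambda>x. f x + - f a) \<rho> (B + \<bar>- f a\<bar>)"
    by (rule series_at_add[OF f series_at_const[OF \<rho>]])
  from series_at_shrink[OF this a _, of "\<rho>' / \<rho>"]
  have "series_at I U a (\<lambda>x. f x - f a) \<rho>' (\<rho>' / \<rho> * (B + \<bar>f a\<bar>))"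
    using assms \<rho> by simp
  from series_at_add[OF this series_at_const[OF \<open>0 < \<rho>'\<close>, of I U a "f a"]]
  have "series_at I U a f \<rho>' (\<rho>' / \<rho> * (B + \<bar>f a\<bar>) + \<bar>f a\<bar>)" by simp
  moreover from series_at_bound[OF this a] have "0 \<le> \<rho>' / \<rho> * (B + \<bar>f a\<bar>) + \<bar>f a\<bar>"
    using assms by simp
  ultimately show ?thesis by blast
qed

section \<open>Locally analytic functions and their closure properties\<close>

definition series_analytic :: "'i set \<Rightarrow> ('i \<Rightarrow> real) set \<Rightarrow> (('i \<Rightarrow> real) \<Rightarrow> real) \<Rightarrow> bool" where
  "series_analytic I U f \<longleftrightarrow> (\<forall>a\<in>U. \<exists>\<rho> B. series_at I U a f \<rho> B)"

lemma series_analytic_imp: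
  assumes "openin (powertop_real I) U" "series_analytic I U f"
  shows "analytic_fun I U f"
  unfolding analytic_fun_def
proof (intro conjI ballI)
  fix a assume "a \<in> U"
  then obtain \<rho> c where "\<rho> > 0" "represents I U a \<rho> c f"
    using assms(2) unfolding series_analytic_def series_at_def by blast
  then show "\<exists>c r. 0 < r \<and> (\<forall>x\<in>U. (\<forall>i\<in>I. \<bar>x i - a i\<bar> < r) \<longrightarrow>
      ((\<lambda>m. c m * monom_at m (\<lambda>i. x i - a i)) has_sum f x) {m. Poly_Mapping.keys m \<subseteq> I})"
    unfolding represents_def by (meson less_imp_le)
qed (use assms in auto)

lemma series_analytic_const: "series_analytic I U (\<lambda>_. v)"
  unfolding series_analytic_def using series_at_const[of 1] by fastforce

lemma series_analytic_coord:
  assumes "i \<in> I"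
  shows "series_analytic I U (\<lambda>x. x i)"
  unfolding series_analytic_def
proof (intro ballI exI)
  fix a
  show "series_at I U a (\<lambda>x. x i) 1 (1 + \<bar>a i\<bar>)"
    using series_at_add[OF series_at_coord[OF zero_less_one assms] series_at_const[OF zero_less_one, of I U a "a i"]]
    by simp
qed

lemma series_analytic_common:
  assumes "series_analytic I U f" "series_analytic I U g" "a \<in> U"
  obtains \<rho> B C where "series_at I U a f \<rho> B" "series_at I U a g \<rho> C" "B \<ge> 0"
proof -
  obtain \<rho> B where f: "series_at I U a f \<rho> B"
    using assms unfolding series_analytic_def by blast
  obtain \<sigma> C where g: "series_at I U a g \<sigma> C"
    using assms unfolding series_analytic_def by blast
  have "\<rho> > 0" "\<sigma> > 0" using f g by (auto simp: series_at_def)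
  then show ?thesis
    using that[of "min \<rho> \<sigma>"] series_at_radius[OF f assms(3), of "min \<rho> \<sigma>"]
      series_at_radius[OF g assms(3), of "min \<rho> \<sigma>"] by auto
qed

lemma series_analytic_add:
  "series_analytic I U f \<Longrightarrow> series_analytic I U g \<Longrightarrow> series_analytic I U (\<lambda>x. f x + g x)"
  unfolding series_analytic_def[of I U "\<lambda>x. f x + g x"]
  by (blast elim: series_analytic_common intro: series_at_add)

lemma series_analytic_mult:
  "series_analytic I U f \<Longrightarrow> series_analytic I U g \<Longrightarrow> series_analytic I U (\<lambda>x. f x * g x)"
  unfolding series_analytic_def[of I U "\<lambda>x. f x * g x"]
  by (blast elim: series_analytic_common intro: series_at_mult)

text \<open>Dividing by \<open>f a\<close> leaves the binomial series of \<open>1 + h\<close> with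
  \<open>h a = 0\<close>, and shrinking the radius brings the majorant of \<open>h\<close> inside
  the unit disc. Exponents -1 and 1/2 give reciprocals and square roots.\<close>

lemma series_analytic_powr:
  assumes f: "series_analytic I U f" and pos: "\<And>x. x \<in> U \<Longrightarrow> f x > 0"
  shows "series_analytic I U (\<lambda>x. f x powr p)"
  unfolding series_analytic_def
proof
  fix a assume a: "a \<in> U"
  define h where "h x = 1 / f a * f x + - 1" for x
  have "series_analytic I U h"
    unfolding h_def by (intro series_analytic_add series_analytic_mult series_analytic_const f)
  then obtain \<rho> B where h: "series_at I U a h \<rho> B" and "B \<ge> 0"
    using series_analytic_common[OF _ _ a] by metis
  have ha: "h a = 0" using pos[OF a] by (simp add: h_def)
  \<comment> \<open>The \<open>+ 1\<close> keeps the denominator positive when \<open>B = 0\<close>;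
    what matters is \<open>t * B \<le> 1 / 2\<close>.\<close>
  define t where "t = 1 / (2 * (B + 1))"
  have t: "0 < t" "t \<le> 1" "t * B \<le> 1 / 2"
    using \<open>B \<ge> 0\<close> by (auto simp: t_def field_simps)
  have h': "series_at I U a h (t * \<rho>) (t * B)"
    by (rule series_at_shrink[OF h a ha t(1,2)])
  \<comment> \<open>Convergence at a point strictly between 1/2 and 1 gives absolute convergence at
    \<open>t * B\<close>.\<close>
  have "summable (\<lambda>k. (p gchoose k) * (3 / 4) ^ k)"
    using gen_binomial_real[of "3/4" p] by (auto simp: summable_def)
  then have "summable (\<lambda>k. norm ((p gchoose k) * (t * B) ^ k))"
    by (rule powser_insidea) (use t \<open>B \<ge> 0\<close> in auto)
  then have sm: "summable (\<lambda>k. \<bar>p gchoose k\<bar> * (t * B) ^ k)"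
    using t \<open>B \<ge> 0\<close> by (simp add: abs_mult power_abs)
  have "\<exists>C. series_at I U a (\<lambda>x. (1 + h x) powr p) (t * \<rho>) C"
  proof (rule series_at_compose[OF h' _ sm])
    fix x assume x: "x \<in> U" "\<forall>i\<in>I. \<bar>x i - a i\<bar> \<le> t * \<rho>"
    have "\<bar>h x\<bar> < 1" using series_at_bound[OF h' x] t by simp
    then show "(\<lambda>k. (p gchoose k) * h x ^ k) sums (1 + h x) powr p"
      by (rule gen_binomial_real)
  qed (use t \<open>B \<ge> 0\<close> in auto)
  then obtain C where C: "series_at I U a (\<lambda>x. (1 + h x) powr p) (t * \<rho>) C" by blast
  have "t * \<rho> > 0" using C by (simp add: series_at_def)
  from series_at_mult[OF series_at_const[OF this, of I U a "f a powr p"] C]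
  have *: "series_at I U a (\<lambda>x. f a powr p * (1 + h x) powr p) (t * \<rho>) (\<bar>f a powr p\<bar> * C)" by simp
  have "f a powr p * (1 + h x) powr p = f x powr p" if "x \<in> U" for x
    using pos[OF a] pos[OF that] by (simp add: h_def powr_divide)
  then have "series_at I U a (\<lambda>x. f x powr p) (t * \<rho>) (\<bar>f a powr p\<bar> * C)"
    using * unfolding series_at_def represents_def by simp
  then show "\<exists>\<rho> B. series_at I U a (\<lambda>x. f x powr p) \<rho> B" by blast
qed

text \<open>Continuity for the product topology is carried along because an analytic isomorphism
  must also be a homeomorphism.\<close>

definition admissible_real :: "'i set \<Rightarrow> ('i \<Rightarrow> real) set \<Rightarrow> (('i \<Rightarrow> real) \<Rightarrow> real) \<Rightarrow> bool" where
  "admissible_real I U f \<longleftrightarrow>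
     series_analytic I U f \<and> continuous_map (subtopology (powertop_real I) U) euclideanreal f"

definition admissible_complex :: "'i set \<Rightarrow> ('i \<Rightarrow> real) set \<Rightarrow> (('i \<Rightarrow> real) \<Rightarrow> complex) \<Rightarrow> bool" where
  "admissible_complex I U f \<longleftrightarrow> admissible_real I U (\<lambda>x. Re (f x)) \<and> admissible_real I U (\<lambda>x. Im (f x))"

lemma admissible_real_const: "admissible_real I U (\<lambda>_. c)"
  by (simp add: admissible_real_def series_analytic_const)

lemma admissible_real_coord: "i \<in> I \<Longrightarrow> admissible_real I U (\<lambda>x. x i)"
  by (auto simp: admissible_real_def series_analytic_coord
      intro!: continuous_map_from_subtopology continuous_map_product_projection)

lemma admissible_real_add: "admissible_real I U f \<Longrightarrow> admissible_real I U g \<Longrightarrow> admissible_real I U (\<lambda>x. f x + g x)"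
  by (simp add: admissible_real_def series_analytic_add continuous_map_add)

lemma admissible_real_mult: "admissible_real I U f \<Longrightarrow> admissible_real I U g \<Longrightarrow> admissible_real I U (\<lambda>x. f x * g x)"
  by (simp add: admissible_real_def series_analytic_mult continuous_map_real_mult)

lemma admissible_real_uminus: "admissible_real I U f \<Longrightarrow> admissible_real I U (\<lambda>x. - f x)"
  using admissible_real_mult[OF admissible_real_const[of I U "-1"]] by simp

lemma admissible_real_diff: "admissible_real I U f \<Longrightarrow> admissible_real I U g \<Longrightarrow> admissible_real I U (\<lambda>x. f x - g x)"
  using admissible_real_add[OF _ admissible_real_uminus] by fastforce

lemma admissible_real_powr:
  assumes f: "admissible_real I U f" and pos: "\<And>x. x \<in> U \<Longrightarrow> f x > 0"
  shows "admissible_real I U (\<lambda>x. f x powr p)"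
proof -
  have "continuous_map (subtopology (powertop_real I) U) (top_of_set {0<..}) f"
    using f pos by (auto simp: admissible_real_def continuous_map_in_subtopology)
  moreover have "continuous_map (top_of_set {0<..}) euclideanreal (\<lambda>t. t powr p)"
    by (simp, intro continuous_intros) auto
  ultimately have "continuous_map (subtopology (powertop_real I) U) euclideanreal ((\<lambda>t. t powr p) \<circ> f)"
    by (rule continuous_map_compose)
  then show ?thesis
    using series_analytic_powr[of I U f p] f pos by (simp add: admissible_real_def o_def)
qed

lemma admissible_real_cong:
  assumes "\<And>x. x \<in> U \<Longrightarrow> f x = g x"
  shows "admissible_real I U f \<longleftrightarrow> admissible_real I U g"
proof -
  have "continuous_map (subtopology (powertop_real I) U) euclideanreal f \<longleftrightarrow>
      continuous_map (subtopology (powertop_real I) U) euclideanreal g"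
    using assms by (auto elim!: continuous_map_eq)
  moreover have "series_analytic I U f \<longleftrightarrow> series_analytic I U g"
    using assms by (simp add: series_analytic_def series_at_def represents_def)
  ultimately show ?thesis by (simp add: admissible_real_def)
qed

lemma admissible_complex_cong:
  "(\<And>x. x \<in> U \<Longrightarrow> f x = g x) \<Longrightarrow> admissible_complex I U f \<longleftrightarrow> admissible_complex I U g"
  unfolding admissible_complex_def by (intro arg_cong2[where f="(\<and>)"] admissible_real_cong) auto

lemma admissible_complex_const: "admissible_complex I U (\<lambda>_. c)"
  by (simp add: admissible_complex_def admissible_real_const)

lemma admissible_complex_add: "admissible_complex I U f \<Longrightarrow> admissible_complex I U g \<Longrightarrow> admissible_complex I U (\<lambda>x. f x + g x)"
  by (simp add: admissible_complex_def admissible_real_add)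

lemma admissible_complex_mult: "admissible_complex I U f \<Longrightarrow> admissible_complex I U g \<Longrightarrow> admissible_complex I U (\<lambda>x. f x * g x)"
  by (simp add: admissible_complex_def admissible_real_add admissible_real_diff admissible_real_mult)

lemma admissible_complex_cnj: "admissible_complex I U f \<Longrightarrow> admissible_complex I U (\<lambda>x. cnj (f x))"
  by (simp add: admissible_complex_def admissible_real_uminus)

lemma admissible_complex_powr:
  "admissible_complex I U f \<Longrightarrow> (\<And>x. x \<in> U \<Longrightarrow> Re (f x) > 0) \<Longrightarrow> admissible_complex I U (\<lambda>x. of_real (Re (f x) powr p))"
  by (simp add: admissible_complex_def admissible_real_const admissible_real_powr)

subsection \<open>Linkages parametrized near the origin\<close>

text \<open>By the law of cosines the distances determine the real part of
  \<open>(u - v) * cnj (u - w)\<close>; they also determine its modulus. Its imaginary part, up to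
  convention twice the signed area of the triangle, is therefore known up to sign, and equal
  orientation fixes the sign.\<close>

lemma circles_intersect_unique:
  fixes u u' v w :: complex
  assumes "cmod (u - v) = cmod (u' - v)" "cmod (u - w) = cmod (u' - w)"
    and "Im ((u - v) * cnj (u - w)) * Im ((u' - v) * cnj (u' - w)) > 0"
  shows "u = u'"
proof -
  define d where "d = w - v"
  have R: "2 * Re ((u - v) * cnj (u - w)) = (cmod (u - v))\<^sup>2 + (cmod (u - w))\<^sup>2 - (cmod d)\<^sup>2" for u
    unfolding d_def cmod_power2 by (simp add: power2_eq_square algebra_simps)
  have M: "(Re z)\<^sup>2 + (Im z)\<^sup>2 = (cmod z)\<^sup>2" for z
    by (simp add: cmod_power2)
  let ?p = "(u - v) * cnj (u - w)" and ?q = "(u' - v) * cnj (u' - w)"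
  have re: "Re ?p = Re ?q"
    using R[of u] R[of u'] assms(1,2) by simp
  have "cmod ?p = cmod ?q"
    using assms(1,2) by (simp only: norm_mult complex_mod_cnj)
  then have "(Im ?p)\<^sup>2 = (Im ?q)\<^sup>2"
    using M[of ?p] M[of ?q] re by (metis add_left_cancel)
  then have "Im ?p = Im ?q \<or> Im ?p = - Im ?q"
    by (simp add: power2_eq_iff)
  moreover have "Im ?p \<noteq> - Im ?q"
    using assms(3) by (metis mult_minus_left not_square_less_zero neg_0_less_iff_less)
  ultimately have pq: "?p = ?q"
    using re complex_eqI by blast
  have "(u - v) * cnj d = (u' - v) * cnj d"
  proof -
    \<comment> \<open>Multiplying \<open>t - v\<close> by \<open>cnj d\<close> gives a squared
      distance minus the product just identified.\<close>
    have e: "(t - v) * cnj d = (t - v) * cnj (t - v) - (t - v) * cnj (t - w)" for t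
      by (simp add: d_def algebra_simps)
    have "(u - v) * cnj (u - v) = (u' - v) * cnj (u' - v)"
      using assms(1) by (metis complex_norm_square)
    then show ?thesis using e[of u] e[of u'] pq by simp
  qed
  moreover have "d \<noteq> 0"
  proof
    assume "d = 0"
    then have "w = v" by (simp add: d_def)
    then have "Im ?p = 0" by (simp add: algebra_simps)
    then show False using assms(3) by (metis mult_zero_left order_less_irrefl)
  qed
  ultimately show ?thesis by simp
qed

text \<open>The sign of the area persists under small perturbations. The centres \<open>v\<close>
  and \<open>w\<close> vary as well, because the far ends of the rods move with the inputs.\<close>

lemma circles_intersect_unique_near:
  fixes u0 v0 w0 :: complex
  assumes "Im ((u0 - v0) * cnj (u0 - w0)) \<noteq> 0"
  obtains \<eta> where "\<eta> > 0"
    "\<And>u u' v w. cmod (u - u0) < \<eta> \<Longrightarrow> cmod (u' - u0) < \<eta> \<Longrightarrow> cmod (v - v0) < \<eta> \<Longrightarrow> cmod (w - w0) < \<eta> \<Longrightarrow>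
       cmod (u - v) = cmod (u' - v) \<Longrightarrow> cmod (u - w) = cmod (u' - w) \<Longrightarrow> u = u'"
proof -
  define s where "s = (\<lambda>(u, v, w). Im ((u - v) * cnj (u - w)))"
  define S where "S = {t. s t * s (u0, v0, w0) > 0}"
  have "continuous_on UNIV s"
    unfolding s_def case_prod_unfold by (intro continuous_intros)
  then have "open S"
    unfolding S_def by (intro open_Collect_less continuous_intros) auto
  moreover have "(u0, v0, w0) \<in> S"
    using assms by (simp add: S_def s_def flip: power2_eq_square)
  ultimately obtain r where r: "r > 0" "\<And>t. dist t (u0, v0, w0) < r \<Longrightarrow> t \<in> S"
    by (meson open_dist)
  have S: "(u, v, w) \<in> S" if "cmod (u - u0) < r / 3" "cmod (v - v0) < r / 3" "cmod (w - w0) < r / 3" for u v w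
  proof (rule r(2))
    have "dist (u, v, w) (u0, v0, w0) \<le> cmod (u - u0) + (cmod (v - v0) + cmod (w - w0))"
      using norm_Pair_le[of "u - u0" "(v - v0, w - w0)"] norm_Pair_le[of "v - v0" "w - w0"]
      by (simp add: dist_norm)
    then show "dist (u, v, w) (u0, v0, w0) < r" using that by simp
  qed
  show ?thesis
  proof (rule that[of "r / 3"])
    fix u u' v w
    assume *: "cmod (u - u0) < r / 3" "cmod (u' - u0) < r / 3" "cmod (v - v0) < r / 3" "cmod (w - w0) < r / 3"
      and eq: "cmod (u - v) = cmod (u' - v)" "cmod (u - w) = cmod (u' - w)"
    have "s (u, v, w) * s (u0, v0, w0) > 0" "s (u', v, w) * s (u0, v0, w0) > 0"
      using S * unfolding S_def by blast+
    then have "s (u, v, w) * s (u', v, w) > 0"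
      by (auto simp: zero_less_mult_iff)
    then show "u = u'"
      by (intro circles_intersect_unique[OF eq]) (simp add: s_def)
  qed (use r in auto)
qed

section \<open>Germs and regular functions at the origin\<close>

locale parametrized_linkage =
  fixes N :: nat and I :: "'i set"
begin

abbreviation origin :: "nat \<Rightarrow> complex" where
  "origin \<equiv> \<lambda>_. 0"

text \<open>Unpunctured neighbourhoods of 0 in the first \<open>N\<close> coordinates, the others
  being arbitrary. Since the origin belongs to all of them, eventual identities hold at the origin
  too.\<close>

definition germ :: "(nat \<Rightarrow> complex) filter" where
  "germ = (INF e\<in>{0<..}. principal {z. \<forall>i<N. cmod (z i) < e})"

lemma eventually_germ: "eventually P germ \<longleftrightarrow> (\<exists>e>0. \<forall>z. (\<forall>i<N. cmod (z i) < e) \<longrightarrow> P z)"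
proof -
  have "eventually P germ \<longleftrightarrow> (\<exists>e\<in>{0<..}. eventually P (principal {z. \<forall>i<N. cmod (z i) < e}))"
    unfolding germ_def
  proof (rule eventually_INF_base)
    fix a b :: real assume "a \<in> {0<..}" "b \<in> {0<..}"
    then show "\<exists>x\<in>{0<..}. principal {z. \<forall>i<N. cmod (z i) < x}
        \<le> inf (principal {z. \<forall>i<N. cmod (z i) < a}) (principal {z. \<forall>i<N. cmod (z i) < b})"
      by (intro bexI[of _ "min a b"]) auto
  qed auto
  then show ?thesis by (auto simp: eventually_principal)
qed

lemma eventually_germ_origin: "eventually P germ \<Longrightarrow> P origin"
  by (auto simp: eventually_germ)

definition preserves :: "real \<Rightarrow> ((nat \<Rightarrow> complex) \<Rightarrow> complex) \<Rightarrow> bool" where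
  "preserves e f \<longleftrightarrow> (\<forall>U Z. (\<forall>i<N. admissible_complex I U (\<lambda>x. Z x i)) \<longrightarrow>
     (\<forall>x\<in>U. \<forall>i<N. cmod (Z x i) < e) \<longrightarrow> admissible_complex I U (\<lambda>x. f (Z x)))"

text \<open>Analyticity is expressed by its effect under substitution, which makes it compose for free.\<close>

definition regular :: "((nat \<Rightarrow> complex) \<Rightarrow> complex) \<Rightarrow> bool" where
  "regular f \<longleftrightarrow> (f \<longlongrightarrow> f origin) germ \<and> (\<exists>e>0. preserves e f)"

lemma preserves_mono: "preserves e f \<Longrightarrow> e' \<le> e \<Longrightarrow> preserves e' f"
  unfolding preserves_def by (meson less_le_trans)

lemma regularE2:
  assumes "regular f" "regular g"
  obtains e where "e > 0" "preserves e f" "preserves e g"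
proof -
  obtain a b where "a > 0" "preserves a f" "b > 0" "preserves b g"
    using assms unfolding regular_def by blast
  then show ?thesis
    using that[of "min a b"] preserves_mono[of a f "min a b"] preserves_mono[of b g "min a b"] by auto
qed

lemma regular_tendsto: "regular f \<Longrightarrow> (f \<longlongrightarrow> f origin) germ"
  by (simp add: regular_def)

lemma regular_const: "regular (\<lambda>_. c)"
  by (auto simp: regular_def preserves_def admissible_complex_const intro: exI[of _ 1])

lemma regular_input:
  assumes "i < N"
  shows "regular (\<lambda>z. z i)"
  unfolding regular_def
proof
  show "((\<lambda>z. z i) \<longlongrightarrow> 0) germ"
    unfolding tendsto_iff eventually_germ using assms by auto
qed (use assms in \<open>auto simp: preserves_def intro: exI[of _ 1]\<close>)

lemma regular_add:
  assumes "regular f" "regular g"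
  shows "regular (\<lambda>z. f z + g z)"
proof -
  obtain e where "e > 0" "preserves e f" "preserves e g"
    using regularE2[OF assms] by blast
  then have "preserves e (\<lambda>z. f z + g z)" by (simp add: preserves_def admissible_complex_add)
  moreover have "((\<lambda>z. f z + g z) \<longlongrightarrow> f origin + g origin) germ"
    by (intro tendsto_add regular_tendsto assms)
  ultimately show ?thesis unfolding regular_def using \<open>e > 0\<close> by blast
qed

lemma regular_mult:
  assumes "regular f" "regular g"
  shows "regular (\<lambda>z. f z * g z)"
proof -
  obtain e where "e > 0" "preserves e f" "preserves e g"
    using regularE2[OF assms] by blast
  then have "preserves e (\<lambda>z. f z * g z)" by (simp add: preserves_def admissible_complex_mult)
  moreover have "((\<lambda>z. f z * g z) \<longlongrightarrow> f origin * g origin) germ"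
    by (intro tendsto_mult regular_tendsto assms)
  ultimately show ?thesis unfolding regular_def using \<open>e > 0\<close> by blast
qed

lemma regular_diff:
  assumes "regular f" "regular g"
  shows "regular (\<lambda>z. f z - g z)"
  using regular_add[OF assms(1) regular_mult[OF regular_const[of "-1"] assms(2)]] by simp

lemma regular_cnj:
  assumes "regular f"
  shows "regular (\<lambda>z. cnj (f z))"
proof -
  obtain e where "e > 0" "preserves e f"
    using assms unfolding regular_def by blast
  then have "preserves e (\<lambda>z. cnj (f z))" by (simp add: preserves_def admissible_complex_cnj)
  moreover have "((\<lambda>z. cnj (f z)) \<longlongrightarrow> cnj (f origin)) germ"
    by (intro tendsto_cnj regular_tendsto assms)
  ultimately show ?thesis unfolding regular_def using \<open>e > 0\<close> by blast
qed

lemma regular_powr: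
  assumes f: "regular f" and pos: "Re (f origin) > 0"
  shows "regular (\<lambda>z. of_real (Re (f z) powr p))"
proof -
  obtain e where e: "e > 0" "preserves e f"
    using f unfolding regular_def by blast
  have lim: "((\<lambda>z. Re (f z)) \<longlongrightarrow> Re (f origin)) germ"
    by (intro tendsto_Re regular_tendsto f)
  then have "\<forall>\<^sub>F z in germ. Re (f z) > 0"
    using pos by (rule order_tendstoD)
  then obtain e' where e': "e' > 0" "\<And>z. (\<forall>i<N. cmod (z i) < e') \<Longrightarrow> Re (f z) > 0"
    by (auto simp: eventually_germ)
  have "preserves (min e e') (\<lambda>z. of_real (Re (f z) powr p))"
    using e(2) e'(2) by (auto simp: preserves_def intro!: admissible_complex_powr)
  moreover have "((\<lambda>z. complex_of_real (Re (f z) powr p)) \<longlongrightarrow> of_real (Re (f origin) powr p)) germ"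
    by (intro tendsto_of_real tendsto_powr lim tendsto_const) (use pos in auto)
  ultimately show ?thesis unfolding regular_def using e(1) e'(1) by (metis min_less_iff_conj)
qed

lemma regular_cong:
  assumes f: "regular f" and eq: "\<forall>\<^sub>F z in germ. f z = g z"
  shows "regular g"
proof -
  have "f origin = g origin" by (rule eventually_germ_origin[OF eq])
  then have "(g \<longlongrightarrow> g origin) germ"
    using regular_tendsto[OF f] tendsto_cong[OF eq] by simp
  moreover obtain e where e: "e > 0" "preserves e f"
    using f unfolding regular_def by blast
  moreover obtain e' where e': "e' > 0" "\<And>z. (\<forall>i<N. cmod (z i) < e') \<Longrightarrow> f z = g z"
    using eq by (auto simp: eventually_germ)
  have "preserves (min e e') g"
    unfolding preserves_def
  proof (intro allI impI)
    fix U Z assume *: "\<forall>i<N. admissible_complex I U (\<lambda>x. Z x i)" "\<forall>x\<in>U. \<forall>i<N. cmod (Z x i) < min e e'"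
    then have "admissible_complex I U (\<lambda>x. f (Z x))"
      using e(2) by (auto simp: preserves_def)
    moreover have "f (Z x) = g (Z x)" if "x \<in> U" for x
      using * that e'(2) by auto
    ultimately show "admissible_complex I U (\<lambda>x. g (Z x))"
      using admissible_complex_cong[of U "\<lambda>x. f (Z x)" "\<lambda>x. g (Z x)" I] by blast
  qed
  ultimately show ?thesis
    unfolding regular_def using e(1) e'(1) by (metis min_less_iff_conj)
qed

section \<open>Systems of vertices and their extension\<close>

definition trunc :: "(nat \<Rightarrow> complex) \<Rightarrow> nat \<Rightarrow> complex" where
  "trunc \<phi> = (\<lambda>i. if i < N then \<phi> i else 0)"

text \<open>
  Vertex \<open>j < k\<close> of the linkage sits at \<open>h j z\<close> when the inputs, vertices \<open>0, \<dots>, N - 1\<close>, sit at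
  \<open>z\<close> near the origin. All edges in \<open>E\<close> are rigid, with length read off at \<open>z = 0\<close>.
  The last clause says that near \<open>z = 0\<close> the linkage has no other positions.
\<close>

definition system ::
  "nat \<Rightarrow> (nat \<Rightarrow> (nat \<Rightarrow> complex) \<Rightarrow> complex) \<Rightarrow> (nat \<times> nat) set \<Rightarrow> nat set \<Rightarrow> bool" where
  "system k h E F \<longleftrightarrow>
     N \<le> k \<and> (\<forall>i<N. h i = (\<lambda>z. z i)) \<and> (\<forall>j<k. regular (h j)) \<and>
     F \<subseteq> {N..<k} \<and> (\<forall>j\<in>F. \<forall>z. h j z = h j origin) \<and>
     (\<forall>(a, b)\<in>E. a < k \<and> b < k \<and> h a origin \<noteq> h b origin) \<and>
     (\<forall>\<^sub>F z in germ. \<forall>(a, b)\<in>E. cmod (h a z - h b z) = cmod (h a origin - h b origin)) \<and>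
     (\<exists>\<delta>>0. \<forall>\<phi>. (\<forall>j<k. cmod (\<phi> j - h j origin) < \<delta>) \<longrightarrow>
        (\<forall>j\<in>F. \<phi> j = h j origin) \<longrightarrow>
        (\<forall>(a, b)\<in>E. cmod (\<phi> a - \<phi> b) = cmod (h a origin - h b origin)) \<longrightarrow>
        (\<forall>j<k. \<phi> j = h j (trunc \<phi>)))"

definition realizable :: "((nat \<Rightarrow> complex) \<Rightarrow> complex) set \<Rightarrow> bool" where
  "realizable H \<longleftrightarrow> (\<exists>k h E F. system k h E F \<and> (\<forall>f\<in>H. \<exists>j<k. \<forall>\<^sub>F z in germ. h j z = f z))"

text \<open>Quantifying over every linkage already built makes the notion cumulative: separate
  realizability of \<open>{f}\<close> and \<open>{g}\<close> would not directly provide one linkage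
  carrying both.\<close>

definition constructible :: "((nat \<Rightarrow> complex) \<Rightarrow> complex) \<Rightarrow> bool" where
  "constructible f \<longleftrightarrow> (\<forall>H. realizable H \<longrightarrow> realizable (insert f H))"

lemma realizable_empty: "realizable {}"
proof -
  have "system N (\<lambda>i z. z i) {} {}"
    unfolding system_def by (auto simp: regular_input trunc_def intro: exI[of _ 1])
  then show ?thesis unfolding realizable_def by blast
qed

lemma realizable_finite: "finite H \<Longrightarrow> (\<And>f. f \<in> H \<Longrightarrow> constructible f) \<Longrightarrow> realizable H"
  by (induction H rule: finite_induct) (auto simp: realizable_empty constructible_def)

lemma constructible_regular:
  assumes "constructible f"
  shows "regular f"
proof -
  have "realizable {f}"
    using assms realizable_empty by (simp add: constructible_def)
  then obtain k h E F j where "system k h E F" "j < k" "\<forall>\<^sub>F z in germ. h j z = f z"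
    unfolding realizable_def by blast
  then show ?thesis
    using regular_cong unfolding system_def by blast
qed

lemma constructible_cong:
  assumes "constructible f" "\<forall>\<^sub>F z in germ. f z = g z"
  shows "constructible g"
  unfolding constructible_def
proof (intro allI impI)
  fix H assume "realizable H"
  then have "realizable (insert f H)" using assms(1) by (simp add: constructible_def)
  then obtain k h E F where S: "system k h E F" "\<forall>f\<in>insert f H. \<exists>j<k. \<forall>\<^sub>F z in germ. h j z = f z"
    unfolding realizable_def by blast
  then obtain j where "j < k" "\<forall>\<^sub>F z in germ. h j z = f z" by blast
  moreover from this(2) assms(2) have "\<forall>\<^sub>F z in germ. h j z = g z"
    by eventually_elim simp
  ultimately have "\<forall>f\<in>insert g H. \<exists>j<k. \<forall>\<^sub>F z in germ. h j z = f z"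
    using S(2) by blast
  then show "realizable (insert g H)"
    unfolding realizable_def using S(1) by blast
qed

lemma constructible_input:
  assumes "i < N"
  shows "constructible (\<lambda>z. z i)"
  unfolding constructible_def
proof (intro allI impI)
  fix H assume "realizable H"
  then obtain k h E F where S: "system k h E F" "\<forall>f\<in>H. \<exists>j<k. \<forall>\<^sub>F z in germ. h j z = f z"
    unfolding realizable_def by blast
  have "i < k" "h i = (\<lambda>z. z i)"
    using S(1) assms by (auto simp: system_def)
  then have "\<exists>j<k. \<forall>\<^sub>F z in germ. h j z = z i"
    by (intro exI[of _ i]) auto
  then show "realizable (insert (\<lambda>z. z i) H)"
    unfolding realizable_def using S by blast
qed

text \<open>The old rods and fixed vertices already force the old vertices into place, so the
  hypothesis \<open>uniq\<close> may assume this and has to settle vertex \<open>k\<close> only.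
  \<open>trunc \<phi>\<close> is unaffected by the new vertex because \<open>N \<le> k\<close>. A
  nonempty \<open>F'\<close> means that the new vertex is fixed.\<close>

lemma system_extend:
  assumes S: "system k h E F" and f: "regular f"
    and E': "\<And>a b. (a, b) \<in> E' \<Longrightarrow> a < k \<and> b = k \<and> h a origin \<noteq> f origin"
    and F': "F' \<subseteq> {k}" "F' \<noteq> {} \<Longrightarrow> \<forall>z. f z = f origin"
    and len: "\<forall>\<^sub>F z in germ. \<forall>(a, b)\<in>E'. cmod (h a z - f z) = cmod (h a origin - f origin)"
    and uniq: "\<exists>\<delta>>0. \<forall>\<phi>. (\<forall>j<k. cmod (\<phi> j - h j origin) < \<delta>) \<longrightarrow> cmod (\<phi> k - f origin) < \<delta> \<longrightarrow>
        (\<forall>j<k. \<phi> j = h j (trunc \<phi>)) \<longrightarrow> (F' \<noteq> {} \<longrightarrow> \<phi> k = f origin) \<longrightarrow>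
        (\<forall>(a, b)\<in>E'. cmod (\<phi> a - \<phi> k) = cmod (h a origin - f origin)) \<longrightarrow> \<phi> k = f (trunc \<phi>)"
  shows "system (Suc k) (h(k := f)) (E \<union> E') (F \<union> F')"
proof -
  let ?h = "h(k := f)"
  have E: "a < k \<and> b < k \<and> h a origin \<noteq> h b origin" if "(a, b) \<in> E" for a b
    using S that unfolding system_def by blast
  have F: "F \<subseteq> {N..<k}" "\<And>j z. j \<in> F \<Longrightarrow> h j z = h j origin"
    using S unfolding system_def by blast+
  have N: "N \<le> k" "\<And>i. i < N \<Longrightarrow> h i = (\<lambda>z. z i)" "\<And>j. j < k \<Longrightarrow> regular (h j)"
    using S unfolding system_def by blast+
  have lE: "\<forall>\<^sub>F z in germ. \<forall>(a, b)\<in>E. cmod (h a z - h b z) = cmod (h a origin - h b origin)"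
    using S unfolding system_def by blast
  obtain \<delta> where \<delta>: "\<delta> > 0" "\<And>\<phi>. \<forall>j<k. cmod (\<phi> j - h j origin) < \<delta> \<Longrightarrow>
        \<forall>j\<in>F. \<phi> j = h j origin \<Longrightarrow>
        \<forall>(a, b)\<in>E. cmod (\<phi> a - \<phi> b) = cmod (h a origin - h b origin) \<Longrightarrow>
        \<forall>j<k. \<phi> j = h j (trunc \<phi>)"
    using S unfolding system_def by blast
  obtain \<delta>' where \<delta>': "\<delta>' > 0" "\<And>\<phi>. \<forall>j<k. cmod (\<phi> j - h j origin) < \<delta>' \<Longrightarrow> cmod (\<phi> k - f origin) < \<delta>' \<Longrightarrow>
        \<forall>j<k. \<phi> j = h j (trunc \<phi>) \<Longrightarrow> (F' \<noteq> {} \<longrightarrow> \<phi> k = f origin) \<Longrightarrow>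
        \<forall>(a, b)\<in>E'. cmod (\<phi> a - \<phi> k) = cmod (h a origin - f origin) \<Longrightarrow> \<phi> k = f (trunc \<phi>)"
    using uniq by blast
  have "\<forall>\<^sub>F z in germ. \<forall>(a, b)\<in>E \<union> E'. cmod (?h a z - ?h b z) = cmod (?h a origin - ?h b origin)"
    using lE len
  proof eventually_elim
    case (elim z)
    show ?case
    proof clarify
      fix a b assume ab: "(a, b) \<in> E \<union> E'"
      show "cmod (?h a z - ?h b z) = cmod (?h a origin - ?h b origin)"
      proof (cases "(a, b) \<in> E")
        case True
        then show ?thesis using elim(1) E[OF True] by auto
      next
        case False
        then have "(a, b) \<in> E'" using ab by simp
        then show ?thesis using elim(2) E'[of a b] by auto
      qed
    qed
  qed
  moreover have "\<forall>j<Suc k. \<phi> j = ?h j (trunc \<phi>)"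
    if near: "\<forall>j<Suc k. cmod (\<phi> j - ?h j origin) < min \<delta> \<delta>'"
      and fxd: "\<forall>j\<in>F \<union> F'. \<phi> j = ?h j origin"
      and rig: "\<forall>(a, b)\<in>E \<union> E'. cmod (\<phi> a - \<phi> b) = cmod (?h a origin - ?h b origin)" for \<phi>
  proof -
    have n: "cmod (\<phi> j - h j origin) < \<delta>" "cmod (\<phi> j - h j origin) < \<delta>'" if "j < k" for j
      using near[rule_format, of j] that by auto
    have nk: "cmod (\<phi> k - f origin) < \<delta>'"
      using near[rule_format, of k] by simp
    have "\<forall>j<k. \<phi> j = h j (trunc \<phi>)"
    proof (rule \<delta>(2))
      show "\<forall>j\<in>F. \<phi> j = h j origin"
        using fxd F(1) by fastforce
      show "\<forall>(a, b)\<in>E. cmod (\<phi> a - \<phi> b) = cmod (h a origin - h b origin)"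
      proof clarify
        fix a b assume "(a, b) \<in> E"
        then show "cmod (\<phi> a - \<phi> b) = cmod (h a origin - h b origin)"
          using bspec[OF rig, of "(a, b)"] E[of a b] by auto
      qed
    qed (use n in auto)
    moreover from this have "\<phi> k = f (trunc \<phi>)"
    proof (intro \<delta>'(2))
      show "F' \<noteq> {} \<longrightarrow> \<phi> k = f origin"
        using fxd F'(1) by fastforce
      show "\<forall>(a, b)\<in>E'. cmod (\<phi> a - \<phi> k) = cmod (h a origin - f origin)"
      proof clarify
        fix a b assume "(a, b) \<in> E'"
        then show "cmod (\<phi> a - \<phi> k) = cmod (h a origin - f origin)"
          using bspec[OF rig, of "(a, b)"] E'[of a b] by auto
      qed
    qed (use n nk in auto)
    ultimately show ?thesis by (auto simp: less_Suc_eq)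
  qed
  moreover have "\<forall>i<N. ?h i = (\<lambda>z. z i)" "\<forall>j<Suc k. regular (?h j)" "F \<union> F' \<subseteq> {N..<Suc k}"
      "\<forall>(a, b)\<in>E \<union> E'. a < Suc k \<and> b < Suc k \<and> ?h a origin \<noteq> ?h b origin"
    using N f F F'(1) E E' by (fastforce simp: less_Suc_eq)+
  moreover have "\<forall>j\<in>F \<union> F'. \<forall>z. ?h j z = ?h j origin"
  proof (intro ballI allI)
    fix j z assume "j \<in> F \<union> F'"
    then consider "j \<in> F" | "j \<in> F'" by blast
    then show "?h j z = ?h j origin"
    proof cases
      case 1
      then have "j \<noteq> k" using F(1) by auto
      then show ?thesis using F(2)[OF 1, of z] by simp
    next
      case 2
      then show ?thesis using F'(1) F'(2)[THEN spec, of z] by auto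
    qed
  qed
  moreover have "N \<le> Suc k" using N(1) by simp
  moreover have "min \<delta> \<delta>' > 0" using \<delta>(1) \<delta>'(1) by simp
  ultimately show ?thesis
    unfolding system_def by blast
qed

lemma realizable_extend:
  assumes "system k h E F" "\<forall>f\<in>H. \<exists>j<k. \<forall>\<^sub>F z in germ. h j z = f z"
    and "system (Suc k) (h(k := f)) E' F'"
  shows "realizable (insert f H)"
proof -
  have "\<forall>g\<in>insert f H. \<exists>j<Suc k. \<forall>\<^sub>F z in germ. (h(k := f)) j z = g z"
  proof
    fix g assume "g \<in> insert f H"
    then consider "g = f" | "g \<in> H" by blast
    then show "\<exists>j<Suc k. \<forall>\<^sub>F z in germ. (h(k := f)) j z = g z"
    proof cases
      case 2
      then obtain j where "j < k" "\<forall>\<^sub>F z in germ. h j z = g z"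
        using assms(2) by blast
      then show ?thesis by (intro exI[of _ j]) auto
    qed (intro exI[of _ k], simp)
  qed
  then show ?thesis unfolding realizable_def using assms(3) by blast
qed

lemma constructible_const: "constructible (\<lambda>_. c)"
  unfolding constructible_def
proof (intro allI impI)
  fix H assume "realizable H"
  then obtain k h E F where S: "system k h E F" "\<forall>f\<in>H. \<exists>j<k. \<forall>\<^sub>F z in germ. h j z = f z"
    unfolding realizable_def by blast
  show "realizable (insert (\<lambda>_. c) H)"
    by (rule realizable_extend[OF S system_extend[where E'="{}" and F'="{k}", OF S(1) regular_const]])
      (auto intro: exI[of _ 1])
qed

text \<open>Transversality at the origin makes the two circles cross, so their second intersection
  point stays at a distance; it also makes both rod lengths positive.\<close>

lemma constructible_two_rods:
  assumes a: "constructible a" and b: "constructible b" and f: "regular f"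
    and fa: "\<forall>\<^sub>F z in germ. cmod (f z - a z) = cmod (f origin - a origin)"
    and fb: "\<forall>\<^sub>F z in germ. cmod (f z - b z) = cmod (f origin - b origin)"
    and transversal: "Im ((f origin - a origin) * cnj (f origin - b origin)) \<noteq> 0"
  shows "constructible f"
  unfolding constructible_def
proof (intro allI impI)
  fix H assume "realizable H"
  \<comment> \<open>Adjoining the endpoints first makes them actual vertices \<open>i\<close> and
    \<open>j\<close>, equal to \<open>a\<close> and \<open>b\<close> only as germs.\<close>
  then have "realizable (insert b (insert a H))"
    using a b by (simp add: constructible_def)
  then obtain k h E F where S: "system k h E F"
      "\<forall>f\<in>insert b (insert a H). \<exists>j<k. \<forall>\<^sub>F z in germ. h j z = f z"
    unfolding realizable_def by blast
  then obtain i j where i: "i < k" "\<forall>\<^sub>F z in germ. h i z = a z"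
    and j: "j < k" "\<forall>\<^sub>F z in germ. h j z = b z"
    by blast
  have i0: "h i origin = a origin" and j0: "h j origin = b origin"
    using eventually_germ_origin[OF i(2)] eventually_germ_origin[OF j(2)] .
  have N: "N \<le> k" "\<And>i. i < N \<Longrightarrow> h i = (\<lambda>z. z i)"
    using S(1) unfolding system_def by blast+
  obtain \<eta> where \<eta>: "\<eta> > 0"
    "\<And>u u' v w. cmod (u - f origin) < \<eta> \<Longrightarrow> cmod (u' - f origin) < \<eta> \<Longrightarrow>
       cmod (v - a origin) < \<eta> \<Longrightarrow> cmod (w - b origin) < \<eta> \<Longrightarrow>
       cmod (u - v) = cmod (u' - v) \<Longrightarrow> cmod (u - w) = cmod (u' - w) \<Longrightarrow> u = u'"
    using circles_intersect_unique_near[OF transversal] by blast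
  have "\<forall>\<^sub>F z in germ. cmod (f z - f origin) < \<eta>"
    using regular_tendsto[OF f] \<eta>(1) by (simp add: tendsto_iff dist_norm)
  from eventually_conj[OF this eventually_conj[OF fa eventually_conj[OF fb eventually_conj[OF i(2) j(2)]]]]
  obtain e where e: "e > 0" "\<And>z. (\<forall>i<N. cmod (z i) < e) \<Longrightarrow> cmod (f z - f origin) < \<eta> \<and>
      cmod (f z - a z) = cmod (f origin - a origin) \<and> cmod (f z - b z) = cmod (f origin - b origin) \<and>
      h i z = a z \<and> h j z = b z"
    unfolding eventually_germ by blast
  have "system (Suc k) (h(k := f)) (E \<union> {(i, k), (j, k)}) (F \<union> {})"
  proof (rule system_extend[OF S(1) f])
    show "\<forall>\<^sub>F z in germ. \<forall>(a, b)\<in>{(i, k), (j, k)}. cmod (h a z - f z) = cmod (h a origin - f origin)"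
      using fa fb i(2) j(2)
      by eventually_elim (simp add: i0 j0 norm_minus_commute)
    show "\<exists>\<delta>>0. \<forall>\<phi>. (\<forall>j<k. cmod (\<phi> j - h j origin) < \<delta>) \<longrightarrow> cmod (\<phi> k - f origin) < \<delta> \<longrightarrow>
        (\<forall>j<k. \<phi> j = h j (trunc \<phi>)) \<longrightarrow> ({} \<noteq> {} \<longrightarrow> \<phi> k = f origin) \<longrightarrow>
        (\<forall>(a, b)\<in>{(i, k), (j, k)}. cmod (\<phi> a - \<phi> k) = cmod (h a origin - f origin)) \<longrightarrow> \<phi> k = f (trunc \<phi>)"
    \<comment> \<open>\<open>\<eta>\<close> excludes the second intersection point; \<open>e\<close>
      keeps the inputs, whose base position is 0, where the germ identities hold.\<close>
    proof (intro exI[of _ "min \<eta> e"] conjI allI impI)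
      fix \<phi> assume near: "\<forall>j<k. cmod (\<phi> j - h j origin) < min \<eta> e" "cmod (\<phi> k - f origin) < min \<eta> e"
        and \<phi>: "\<forall>j<k. \<phi> j = h j (trunc \<phi>)"
        and rig: "\<forall>(a, b)\<in>{(i, k), (j, k)}. cmod (\<phi> a - \<phi> k) = cmod (h a origin - f origin)"
      have "\<forall>i<N. cmod (trunc \<phi> i) < e"
      proof (intro allI impI)
        fix i assume "i < N"
        then show "cmod (trunc \<phi> i) < e"
          using near(1)[rule_format, of i] N by (simp add: trunc_def)
      qed
      note z = e(2)[OF this]
      have ij: "\<phi> i = a (trunc \<phi>)" "\<phi> j = b (trunc \<phi>)"
        using \<phi> i(1) j(1) z by auto
      have "cmod (\<phi> i - \<phi> k) = cmod (a origin - f origin)" "cmod (\<phi> j - \<phi> k) = cmod (b origin - f origin)"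
        using rig i0 j0 by auto
      then have d: "cmod (\<phi> k - \<phi> i) = cmod (f (trunc \<phi>) - \<phi> i)" "cmod (\<phi> k - \<phi> j) = cmod (f (trunc \<phi>) - \<phi> j)"
        using z ij by (metis norm_minus_commute)+
      show "\<phi> k = f (trunc \<phi>)"
        by (rule \<eta>(2)[OF _ _ _ _ d]) (use near i j i0 j0 z in auto)
    qed (use \<eta> e in auto)
  qed (use i j i0 j0 transversal in auto)
  then show "realizable (insert f H)"
    using realizable_extend[OF S(1)] S(2) by blast
qed

subsection \<open>Elbows, inversors and adders\<close>

definition rigid :: "((nat \<Rightarrow> complex) \<Rightarrow> complex) \<Rightarrow> ((nat \<Rightarrow> complex) \<Rightarrow> complex) \<Rightarrow> bool" where
  "rigid f g \<longleftrightarrow> (\<forall>\<^sub>F z in germ. cmod (f z - g z) = cmod (f origin - g origin))"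

lemma rigidI:
  assumes "\<forall>\<^sub>F z in germ. cmod (f z - g z) = c"
  shows "rigid f g"
  unfolding rigid_def using assms eventually_germ_origin[OF assms] by simp

lemma rigid_commute: "rigid f g \<longleftrightarrow> rigid g f"
  by (simp add: rigid_def norm_minus_commute)

text \<open>Opposite sides are equal, so rigidity of the sides at \<open>p\<close> yields the two
  new rods. Transversality forbids the flat position, from which a parallelogram could pass into an
  antiparallelogram.\<close>

lemma constructible_parallelogram:
  assumes p: "constructible p" and a: "constructible a" and b: "constructible b"
    and pa: "rigid p a" and pb: "rigid p b"
    and transversal: "Im ((a origin - p origin) * cnj (b origin - p origin)) \<noteq> 0"
  shows "constructible (\<lambda>z. a z + b z - p z)"
proof (rule constructible_two_rods[OF a b])
  show "regular (\<lambda>z. a z + b z - p z)"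
    by (intro regular_add regular_diff constructible_regular p a b)
  show "\<forall>\<^sub>F z in germ. cmod (a z + b z - p z - a z) = cmod (a origin + b origin - p origin - a origin)"
    using pb by (simp add: rigid_def norm_minus_commute)
  show "\<forall>\<^sub>F z in germ. cmod (a z + b z - p z - b z) = cmod (a origin + b origin - p origin - b origin)"
    using pa by (simp add: rigid_def norm_minus_commute)
  show "Im ((a origin + b origin - p origin - a origin) * cnj (a origin + b origin - p origin - b origin)) \<noteq> 0"
    using transversal by (simp add: algebra_simps)
qed

text \<open>
  A vertex joined to \<open>p\<close> and \<open>q\<close> by two rods; \<open>Complex (\<alpha> z) (s * \<beta> z)\<close> is its position in the frame
  with origin \<open>p\<close> and first axis \<open>q - p\<close>, and \<open>s\<close> selects the side of the line through \<open>p\<close> and \<open>q\<close>.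
\<close>

lemma constructible_elbow:
  assumes p: "constructible p" and q: "constructible q"
    and pq: "p origin \<noteq> q origin" and \<beta>0: "\<beta>0 > 0"
  shows "\<exists>\<alpha> \<beta> :: (nat \<Rightarrow> complex) \<Rightarrow> real. \<alpha> origin = \<alpha>0 \<and> \<beta> origin = \<beta>0 \<and>
    (\<forall>\<^sub>F z in germ. (cmod (q z - p z))\<^sup>2 * (2 * \<alpha> z - 1) = (cmod (q origin - p origin))\<^sup>2 * (2 * \<alpha>0 - 1)) \<and>
    (\<forall>s f. s \<in> {1, -1} \<longrightarrow> f = (\<lambda>z. p z + (q z - p z) * Complex (\<alpha> z) (s * \<beta> z)) \<longrightarrow>
       constructible f \<and> rigid f p \<and> rigid f q)"
proof -
  define E where "E z = (q z - p z) * cnj (q z - p z)" for z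
  define D where "D z = (cmod (q z - p z))\<^sup>2" for z
  \<comment> \<open>\<open>r\<close> will be the squared length of the rod to \<open>p\<close> and
    \<open>r - K\<close> that of the rod to \<open>q\<close>. The equations
    \<open>D * (\<alpha>^2 + \<beta>^2) = r\<close> and \<open>D * (2 * \<alpha> - 1) = K\<close>
    are then solved for \<open>\<alpha>\<close> and \<open>\<beta>\<close>.\<close>
  define K where "K = D origin * (2 * \<alpha>0 - 1)"
  define r where "r = D origin * (\<alpha>0\<^sup>2 + \<beta>0\<^sup>2)"
  define \<alpha> where "\<alpha> z = 1 / 2 + K / 2 * (D z powr -1)" for z
  define G where "G z = r * (D z powr -1) - (\<alpha> z)\<^sup>2" for z
  \<comment> \<open>The positive root, in accordance with \<open>\<beta>0 > 0\<close>. Root and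
    reciprocals are all written with \<open>powr\<close>, so that \<open>regular_powr\<close> covers
    them.\<close>
  define \<beta> where "\<beta> z = G z powr (1 / 2)" for z
  have DE: "D z = Re (E z)" for z
    by (simp add: D_def E_def cmod_power2) (simp add: power2_eq_square algebra_simps)
  have D0: "D origin > 0" using pq by (simp add: D_def)
  have rp: "regular p" and rq: "regular q" using p q by (auto intro: constructible_regular)
  have rE: "regular E"
    unfolding E_def by (intro regular_mult regular_diff regular_cnj rp rq)
  have rD: "regular (\<lambda>z. of_real (D z powr -1))"
    unfolding DE by (rule regular_powr[OF rE]) (use D0 DE in simp)
  have r\<alpha>: "regular (\<lambda>z. of_real (\<alpha> z))"
    unfolding \<alpha>_def of_real_add of_real_mult by (intro regular_add regular_mult regular_const rD)
  have rG: "regular (\<lambda>z. of_real (G z))"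
    unfolding G_def of_real_diff of_real_mult power2_eq_square
    by (intro regular_diff regular_mult regular_const rD r\<alpha>)
  have \<alpha>0: "\<alpha> origin = \<alpha>0"
    using D0 by (simp add: \<alpha>_def K_def powr_minus field_simps)
  have G0: "G origin = \<beta>0\<^sup>2"
    using D0 by (simp add: G_def \<alpha>0 r_def powr_minus field_simps)
  have \<beta>0': "\<beta> origin = \<beta>0"
    using \<beta>0 by (simp add: \<beta>_def G0 powr_half_sqrt)
  have r\<beta>: "regular (\<lambda>z. of_real (\<beta> z))"
    using regular_powr[OF rG, of "1/2"] \<beta>0 G0 by (simp add: \<beta>_def)
  have "((\<lambda>z. Re (E z)) \<longlongrightarrow> Re (E origin)) germ"
    by (intro tendsto_Re regular_tendsto rE)
  then have eD: "\<forall>\<^sub>F z in germ. D z > 0"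
    using D0 unfolding DE by (rule order_tendstoD)
  have "((\<lambda>z. Re (of_real (G z))) \<longlongrightarrow> Re (of_real (G origin))) germ"
    by (intro tendsto_Re regular_tendsto[OF rG])
  then have eG: "\<forall>\<^sub>F z in germ. G z > 0"
    using G0 \<beta>0 by (auto intro: order_tendstoD)
  have \<alpha>: "D z * (2 * \<alpha> z - 1) = K" if "D z > 0" for z
    using that by (simp add: \<alpha>_def powr_minus field_simps)
  have \<beta>: "D z * ((\<alpha> z)\<^sup>2 + (\<beta> z)\<^sup>2) = r" if "D z > 0" "G z > 0" for z
    using that by (simp add: \<beta>_def powr_half_sqrt) (simp add: G_def powr_minus field_simps)
  show ?thesis
  proof (rule exI[of _ \<alpha>], rule exI[of _ \<beta>], rule conjI[OF \<alpha>0], rule conjI[OF \<beta>0'], rule conjI, goal_cases)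
    case 1
    show ?case
      using eD by eventually_elim (use \<alpha> in \<open>simp add: K_def D_def\<close>)
  next
    case 2
    show ?case
    proof (intro allI impI)
    fix s :: real and f
    assume s: "s \<in> {1, -1}" and f: "f = (\<lambda>z. p z + (q z - p z) * Complex (\<alpha> z) (s * \<beta> z))"
    have s2: "s\<^sup>2 = 1" using s by auto
    have fq: "f z - q z = (q z - p z) * Complex (\<alpha> z - 1) (s * \<beta> z)" for z
      by (simp add: f complex_eq_iff algebra_simps)
    have sq: "(cmod (f z - p z))\<^sup>2 = r \<and> (cmod (f z - q z))\<^sup>2 = r - K" if "D z > 0" "G z > 0" for z
    proof -
      have "(cmod (f z - p z))\<^sup>2 = D z * ((\<alpha> z)\<^sup>2 + (\<beta> z)\<^sup>2)"
        by (simp add: f D_def norm_mult power_mult_distrib s2 cmod_power2[of "Complex _ _"])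
      moreover have "(cmod (f z - q z))\<^sup>2 = D z * ((\<alpha> z)\<^sup>2 + (\<beta> z)\<^sup>2) - D z * (2 * \<alpha> z - 1)"
        unfolding fq by (simp add: D_def norm_mult power_mult_distrib s2 cmod_power2[of "Complex _ _"])
          (simp add: power2_eq_square algebra_simps)
      ultimately show ?thesis using \<alpha> \<beta> that by simp
    qed
    have "\<forall>\<^sub>F z in germ. cmod (f z - p z) = sqrt r"
      using eD eG by eventually_elim (metis sq norm_ge_zero real_sqrt_unique)
    then have fp': "rigid f p" by (rule rigidI)
    have "\<forall>\<^sub>F z in germ. cmod (f z - q z) = sqrt (r - K)"
      using eD eG by eventually_elim (metis sq norm_ge_zero real_sqrt_unique)
    then have fq': "rigid f q" by (rule rigidI)
    have "regular (\<lambda>z. p z + (q z - p z) * (of_real (\<alpha> z) + of_real s * \<i> * of_real (\<beta> z)))"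
      by (intro regular_add regular_mult regular_diff regular_const rp rq r\<alpha> r\<beta>)
    moreover have "p z + (q z - p z) * (of_real (\<alpha> z) + of_real s * \<i> * of_real (\<beta> z)) = f z" for z
      by (simp add: f Complex_eq algebra_simps)
    ultimately have rf: "regular f" by simp
    have "(f origin - p origin) * cnj (f origin - q origin)
        = E origin * (Complex \<alpha>0 (s * \<beta>0) * cnj (Complex (\<alpha>0 - 1) (s * \<beta>0)))"
      unfolding fq by (simp add: f E_def \<alpha>0 \<beta>0' mult_ac)
    also have "E origin = of_real (D origin)"
      by (simp add: E_def D_def complex_norm_square del: of_real_power)
    finally have "Im ((f origin - p origin) * cnj (f origin - q origin)) = - D origin * (s * \<beta>0)"
      by (simp add: algebra_simps)
    moreover have "D origin * (s * \<beta>0) \<noteq> 0" using D0 \<beta>0 s by auto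
    ultimately have "Im ((f origin - p origin) * cnj (f origin - q origin)) \<noteq> 0" by simp
    then have "constructible f"
      by (rule constructible_two_rods[OF p q rf fp'[unfolded rigid_def] fq'[unfolded rigid_def]])
    then show "constructible f \<and> rigid f p \<and> rigid f q"
      using fp' fq' by blast
    qed
  qed
qed

text \<open>Peaucellier's inversor: two mirror-image elbows over \<open>P\<close> and \<open>q\<close>, completed to a rhombus.\<close>

lemma constructible_inversion:
  fixes P :: complex and k :: real
  assumes q: "constructible q" and Pq: "q origin \<noteq> P"
    and k: "k \<noteq> (cmod (q origin - P))\<^sup>2"
  shows "constructible (\<lambda>z. P + of_real k / cnj (q z - P))"
proof -
  define D0 where "D0 = (cmod (q origin - P))\<^sup>2"
  have D0: "D0 > 0" using Pq by (simp add: D0_def)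
  \<comment> \<open>Makes the conserved quantity \<open>D0 * (2 * \<alpha>0 - 1)\<close> equal to
    \<open>k\<close>. For \<open>\<alpha>0 = 1\<close>, that is \<open>k = D0\<close>, the points
    \<open>c\<close>, \<open>q\<close>, \<open>d\<close> would be collinear at the origin and the
    rhombus flat.\<close>
  define \<alpha>0 where "\<alpha>0 = (k / D0 + 1) / 2"
  have K: "D0 * (2 * \<alpha>0 - 1) = k" using D0 by (simp add: \<alpha>0_def field_simps)
  have \<alpha>1: "\<alpha>0 \<noteq> 1" using K k unfolding D0_def[symmetric] by auto
  obtain \<alpha> \<beta> where ab: "\<alpha> origin = \<alpha>0" "\<beta> origin = 1"
    and \<alpha>: "\<forall>\<^sub>F z in germ. (cmod (q z - P))\<^sup>2 * (2 * \<alpha> z - 1) = (cmod (q origin - P))\<^sup>2 * (2 * \<alpha>0 - 1)"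
    and cd: "\<And>s f. s \<in> {1, -1} \<Longrightarrow> f = (\<lambda>z. P + (q z - P) * Complex (\<alpha> z) (s * \<beta> z)) \<Longrightarrow>
       constructible f \<and> rigid f (\<lambda>_. P) \<and> rigid f q"
    using constructible_elbow[OF constructible_const q Pq[symmetric] zero_less_one, of \<alpha>0] by blast
  define c where "c = (\<lambda>z. P + (q z - P) * Complex (\<alpha> z) (1 * \<beta> z))"
  define d where "d = (\<lambda>z. P + (q z - P) * Complex (\<alpha> z) (-1 * \<beta> z))"
  have c: "constructible c" "rigid q c" using cd[OF _ c_def] rigid_commute by blast+
  have d: "constructible d" "rigid q d" using cd[OF _ d_def] rigid_commute by blast+
  have cq: "c origin - q origin = (q origin - P) * Complex (\<alpha>0 - 1) 1"
    and dq: "d origin - q origin = (q origin - P) * Complex (\<alpha>0 - 1) (-1)"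
    by (simp_all add: c_def d_def ab complex_eq_iff algebra_simps)
  have "(c origin - q origin) * cnj (d origin - q origin)
      = of_real D0 * (Complex (\<alpha>0 - 1) 1 * cnj (Complex (\<alpha>0 - 1) (-1)))"
    unfolding cq dq D0_def complex_norm_square complex_cnj_mult by (simp only: mult_ac)
  then have "Im ((c origin - q origin) * cnj (d origin - q origin)) = 2 * D0 * (\<alpha>0 - 1)"
    by (simp add: algebra_simps)
  then have "Im ((c origin - q origin) * cnj (d origin - q origin)) \<noteq> 0"
    using D0 \<alpha>1 by simp
  then have "constructible (\<lambda>z. c z + d z - q z)"
    by (rule constructible_parallelogram[OF q c(1) d(1) c(2) d(2)])
  moreover have "\<forall>\<^sub>F z in germ. c z + d z - q z = P + of_real k / cnj (q z - P)"
    using \<alpha>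
  proof eventually_elim
    case (elim z)
    define w where "w = q z - P"
    \<comment> \<open>The elbows are mirror images, so the \<open>\<beta>\<close> terms
      cancel.\<close>
    have "c z + d z - q z = P + w * of_real (2 * \<alpha> z - 1)"
      by (simp add: c_def d_def w_def complex_eq_iff algebra_simps)
    moreover have "w * of_real (2 * \<alpha> z - 1) = of_real k / cnj w"
    proof (cases "w = 0")
      case False
      have "of_real k = (of_real ((cmod w)\<^sup>2 * (2 * \<alpha> z - 1)) :: complex)"
        using elim K by (simp add: w_def D0_def)
      also have "\<dots> = w * cnj w * of_real (2 * \<alpha> z - 1)"
        by (simp only: of_real_mult complex_norm_square)
      finally show ?thesis using False by (simp add: field_simps)
    qed simp
    ultimately show ?case by (simp add: w_def)
  qed
  ultimately show ?thesis by (rule constructible_cong)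
qed

text \<open>\<open>P\<close>, \<open>x\<close>, \<open>y\<close> are collinear at the origin and
  their distances vary, so no single rigid parallelogram adds them. Elbows \<open>c\<close> and
  \<open>d\<close> split each vector into two rods; the four parallelograms with corners
  \<open>m\<close>, \<open>a\<close>, \<open>b\<close> and the sum add these rods pairwise.\<close>

lemma constructible_vector_sum:
  fixes P :: complex
  assumes x: "constructible x" and y: "constructible y"
    and real: "x origin \<in> \<real>" "y origin \<in> \<real>" "P \<in> \<real>" and ne: "x origin \<noteq> P" "y origin \<noteq> P"
  shows "constructible (\<lambda>z. x z + y z - P)"
proof -
  have half: "(0::real) < 1 / 2" by simp
  obtain \<alpha> \<beta> where ab: "\<alpha> origin = 1/2" "\<beta> origin = 1/2"
    and cd: "\<And>s f. s \<in> {1, -1} \<Longrightarrow> f = (\<lambda>z. P + (x z - P) * Complex (\<alpha> z) (s * \<beta> z)) \<Longrightarrow>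
       constructible f \<and> rigid f (\<lambda>_. P) \<and> rigid f x"
    using constructible_elbow[OF constructible_const x ne(1)[symmetric] half, of "1/2"] by blast
  \<comment> \<open>Height 1 instead of 1/2: with equal heights \<open>c - P\<close> and
    \<open>d - P\<close> would be parallel at the origin.\<close>
  obtain \<alpha>' \<beta>' where ab': "\<alpha>' origin = 1/2" "\<beta>' origin = 1"
    and cd': "\<And>s f. s \<in> {1, -1} \<Longrightarrow> f = (\<lambda>z. P + (y z - P) * Complex (\<alpha>' z) (s * \<beta>' z)) \<Longrightarrow>
       constructible f \<and> rigid f (\<lambda>_. P) \<and> rigid f y"
    using constructible_elbow[OF constructible_const y ne(2)[symmetric] zero_less_one, of "1/2"] by blast
  define c where "c = (\<lambda>z. P + (x z - P) * Complex (\<alpha> z) (1 * \<beta> z))"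
  define d where "d = (\<lambda>z. P + (y z - P) * Complex (\<alpha>' z) (1 * \<beta>' z))"
  have c: "constructible c" "rigid c (\<lambda>_. P)" "rigid c x" using cd[OF _ c_def] by blast+
  have d: "constructible d" "rigid d (\<lambda>_. P)" "rigid d y" using cd'[OF _ d_def] by blast+
  obtain u where u: "x origin - P = of_real u" "u \<noteq> 0"
    using real ne by (metis Reals_cases Reals_diff eq_iff_diff_eq_0 of_real_0)
  obtain v where v: "y origin - P = of_real v" "v \<noteq> 0"
    using real ne by (metis Reals_cases Reals_diff eq_iff_diff_eq_0 of_real_0)
  have cP: "c origin - P = Complex (u / 2) (u / 2)" and dP: "d origin - P = Complex (v / 2) v"
    using u v by (auto simp: c_def d_def ab ab' complex_eq_iff)
  have xc: "x origin - c origin = Complex (u / 2) (- u / 2)" and yd: "y origin - d origin = Complex (v / 2) (- v)"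
    using cP dP u v by (auto simp: complex_eq_iff)
  define m where "m z = c z + d z - P" for z
  have m: "constructible m"
    unfolding m_def
    by (rule constructible_parallelogram[OF constructible_const c(1) d(1)])
      (use c d u v rigid_commute in \<open>auto simp: cP dP\<close>)
  have mc: "rigid c m"
    using d(2) by (simp add: rigid_def m_def norm_minus_commute)
  have md: "rigid d m"
    using c(2) by (simp add: rigid_def m_def norm_minus_commute)
  define a where "a z = x z + m z - c z" for z
  have a: "constructible a"
    unfolding a_def
    by (rule constructible_parallelogram[OF c(1) x m c(3) mc])
      (use u v in \<open>simp add: xc m_def dP\<close>)
  define b where "b z = y z + m z - d z" for z
  have b: "constructible b"
    unfolding b_def
    by (rule constructible_parallelogram[OF d(1) y m d(3) md])
      (use u v in \<open>simp add: yd m_def cP\<close>)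
  have "constructible (\<lambda>z. a z + b z - m z)"
  proof (rule constructible_parallelogram[OF m a b])
    show "rigid m a" "rigid m b"
      using c(3) d(3) by (auto simp: rigid_def a_def b_def algebra_simps norm_minus_commute)
    show "Im ((a origin - m origin) * cnj (b origin - m origin)) \<noteq> 0"
      using u v by (simp add: a_def b_def xc yd)
  qed
  moreover have "a z + b z - m z = x z + y z - P" for z
    by (simp add: a_def b_def m_def)
  ultimately show ?thesis by simp
qed

subsection \<open>Computing polynomials\<close>

text \<open>Real at the origin only, as the adder requires; away from the origin the values may be
  complex.\<close>

definition computable :: "((nat \<Rightarrow> complex) \<Rightarrow> complex) \<Rightarrow> bool" where
  "computable f \<longleftrightarrow> constructible f \<and> f origin \<in> \<real>"

lemma computable_cong:
  assumes "computable f" "\<forall>\<^sub>F z in germ. f z = g z"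
  shows "computable g"
  using assms constructible_cong eventually_germ_origin[OF assms(2)] unfolding computable_def by metis

lemma computable_const: "c \<in> \<real> \<Longrightarrow> computable (\<lambda>_. c)"
  by (simp add: computable_def constructible_const)

lemma computable_input: "i < N \<Longrightarrow> computable (\<lambda>z. z i)"
  by (simp add: computable_def constructible_input)

lemma computable_translate:
  assumes x: "computable x" and c: "c \<in> \<real>"
  shows "computable (\<lambda>z. x z + c)"
proof (cases "c = 0")
  case False
  \<comment> \<open>The base point \<open>x origin + 1\<close> differs from \<open>x origin\<close>
    by 1 and from the constant summand by \<open>c\<close>, hence the separate case
    \<open>c = 0\<close>.\<close>
  have "constructible (\<lambda>z. x z + (x origin + 1 + c) - (x origin + 1))"
    by (rule constructible_vector_sum[OF _ constructible_const])
      (use x c False in \<open>auto simp: computable_def add_eq_0_iff\<close>)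
  then show ?thesis using x c by (simp add: computable_def add_ac)
qed (use x in simp)

lemma computable_add:
  assumes x: "computable x" and y: "computable y"
  shows "computable (\<lambda>z. x z + y z)"
proof -
  define P :: complex where "P = of_real (cmod (x origin) + cmod (y origin) + 1)"
  have "cmod P = cmod (x origin) + cmod (y origin) + 1"
    unfolding P_def norm_of_real by simp
  then have "x origin \<noteq> P" "y origin \<noteq> P"
    using norm_ge_zero[of "x origin"] norm_ge_zero[of "y origin"] by fastforce+
  then have "constructible (\<lambda>z. x z + y z - P)"
    using x y by (intro constructible_vector_sum) (auto simp: computable_def P_def)
  then have "computable (\<lambda>z. x z + y z - P)"
    using x y by (auto simp: computable_def P_def)
  from computable_translate[OF this, of P] show ?thesis by (simp add: P_def)
qed

lemma computable_inverse:
  assumes q: "computable q" "q origin \<noteq> 0" and k: "of_real k \<noteq> (q origin)\<^sup>2"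
  shows "computable (\<lambda>z. of_real k / cnj (q z))"
proof -
  obtain r where r: "q origin = of_real r"
    using q(1) by (auto simp: computable_def elim: Reals_cases)
  have "k \<noteq> (cmod (q origin - 0))\<^sup>2"
    using k by (auto simp: r simp flip: of_real_power)
  then have "constructible (\<lambda>z. 0 + of_real k / cnj (q z - 0))"
    using q by (intro constructible_inversion) (auto simp: computable_def)
  then show ?thesis by (simp add: computable_def r flip: of_real_divide)
qed

text \<open>Two inversions in concentric circles compose to a homothety.\<close>

lemma computable_scale:
  assumes f: "computable f" and c: "c \<in> \<real>"
  shows "computable (\<lambda>z. c * f z)"
proof -
  obtain c' where c': "c = of_real c'" using c by (auto elim: Reals_cases)
  \<comment> \<open>The shift moves the base value to 1, away from the inversion centre 0.\<close>
  define b where "b = 1 - f origin"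
  have b: "b \<in> \<real>" using f by (simp add: b_def computable_def)
  \<comment> \<open>The two inversions are nondegenerate if \<open>k \<noteq> 1\<close> and
    \<open>c' * k \<noteq> k^2\<close>; one of 2 and 3 always works.\<close>
  define k :: real where "k = (if c' = 2 then 3 else 2)"
  have k: "k \<noteq> 1" "k \<noteq> 0" "c' \<noteq> k" by (auto simp: k_def)
  define g where "g z = f z + b" for z
  have g: "computable g" "g origin = 1"
    unfolding g_def using computable_translate[OF f b] by (auto simp: b_def)
  have h: "computable (\<lambda>z. of_real k / cnj (g z))"
    by (rule computable_inverse) (use g k in auto)
  have "c' * k \<noteq> k\<^sup>2" using k by (simp add: power2_eq_square)
  then have "(of_real (c' * k) :: complex) \<noteq> (of_real k)\<^sup>2"
    by (metis of_real_eq_iff of_real_power)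
  then have "computable (\<lambda>z. of_real (c' * k) / cnj (of_real k / cnj (g z)))"
    by (intro computable_inverse[OF h]) (use g k in auto)
  moreover have "of_real (c' * k) / cnj (of_real k / cnj (g z)) = c * g z" for z
    using k by (simp add: c')
  ultimately have "computable (\<lambda>z. c * g z)" by simp
  from computable_translate[OF this, of "- c * b"] show ?thesis
    using c b by (simp add: g_def algebra_simps)
qed

text \<open>Partial fractions: \<open>2/(1 + h) + 2/(1 - h) = 4/(1 - h^2)\<close>, and one more
  inversion returns \<open>1 - h^2\<close>; the conjugations cancel. The powers 2 and 4 avoid the
  excluded values 1 and 16, the squares of the base values being inverted.\<close>

lemma computable_square_small:
  assumes h: "computable h" and h0: "h origin = 0"
  shows "computable (\<lambda>z. (h z)\<^sup>2)"
proof -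
  have "computable (\<lambda>z. of_real 2 / cnj (h z + 1))"
    by (rule computable_inverse[OF computable_translate[OF h]]) (use h0 in auto)
  moreover have "computable (\<lambda>z. of_real 2 / cnj ((- 1) * h z + 1))"
    by (rule computable_inverse[OF computable_translate[OF computable_scale[OF h]]]) (use h0 in auto)
  ultimately have "computable (\<lambda>z. of_real 2 / cnj (h z + 1) + of_real 2 / cnj ((- 1) * h z + 1))"
    by (rule computable_add)
  then have "computable (\<lambda>z. of_real 4 / cnj (of_real 2 / cnj (h z + 1) + of_real 2 / cnj ((- 1) * h z + 1)))"
    by (rule computable_inverse) (use h0 in auto)
  then have "computable (\<lambda>z. (- 1) * (of_real 4 / cnj (of_real 2 / cnj (h z + 1) + of_real 2 / cnj ((- 1) * h z + 1))) + 1)"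
    by (intro computable_translate computable_scale) auto
  moreover have "\<forall>\<^sub>F z in germ. (- 1) * (of_real 4 / cnj (of_real 2 / cnj (h z + 1) + of_real 2 / cnj ((- 1) * h z + 1))) + 1 = (h z)\<^sup>2"
  proof -
    have "(h \<longlongrightarrow> 0) germ"
      using h h0 regular_tendsto[OF constructible_regular] by (fastforce simp: computable_def)
    then have "\<forall>\<^sub>F z in germ. cmod (h z) < 1"
      by (simp add: tendsto_iff)
    then show ?thesis
    proof eventually_elim
      case (elim z)
      then have ne: "1 + h z \<noteq> 0" "1 - h z \<noteq> 0"
        by (metis add_eq_0_iff norm_minus_cancel norm_one order_less_irrefl,
            metis eq_iff_diff_eq_0 norm_one order_less_irrefl)
      have "of_real 2 / (h z + 1) + of_real 2 / (- 1 * h z + 1) = 4 / ((1 + h z) * (1 - h z))"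
        using ne by (simp add: field_simps)
      then show ?case using ne by (simp add: power2_eq_square algebra_simps) (simp add: field_simps)
    qed
  qed
  ultimately show ?thesis by (rule computable_cong)
qed

lemma computable_square:
  assumes f: "computable f"
  shows "computable (\<lambda>z. (f z)\<^sup>2)"
proof -
  define c where "c = f origin"
  have c: "c \<in> \<real>" using f by (simp add: c_def computable_def)
  have "computable (\<lambda>z. (f z + - c)\<^sup>2)"
    by (rule computable_square_small[OF computable_translate[OF f]]) (use c in \<open>auto simp: c_def\<close>)
  then have "computable (\<lambda>z. (f z + - c)\<^sup>2 + (2 * c) * f z + - c\<^sup>2)"
    using c f by (intro computable_translate computable_add computable_scale) auto
  then show ?thesis by (simp add: power2_eq_square algebra_simps)
qed

text \<open>Polarization reduces products to squares.\<close>

lemma computable_mult: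
  assumes f: "computable f" and g: "computable g"
  shows "computable (\<lambda>z. f z * g z)"
proof -
  have "computable (\<lambda>z. (1/2) * ((f z + g z)\<^sup>2 + (- 1) * ((f z)\<^sup>2 + (g z)\<^sup>2)))"
    using f g by (intro computable_scale computable_add computable_square) auto
  then show ?thesis by (simp add: power2_eq_square algebra_simps)
qed

lemma computable_power: "computable f \<Longrightarrow> computable (\<lambda>z. f z ^ m)"
  by (induction m) (auto intro: computable_const computable_mult)

lemma computable_sum: "(\<And>i. i \<in> A \<Longrightarrow> computable (f i)) \<Longrightarrow> computable (\<lambda>z. \<Sum>i\<in>A. f i z)"
  by (induction A rule: infinite_finite_induct) (auto intro: computable_const computable_add)

lemma computable_prod: "(\<And>i. i \<in> A \<Longrightarrow> computable (f i)) \<Longrightarrow> computable (\<lambda>z. \<Prod>i\<in>A. f i z)"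
  by (induction A rule: infinite_finite_induct) (auto intro: computable_const computable_mult)

end

subsection \<open>Compact quasialgebraic sets\<close>

text \<open>Lets a linkage be described by ordered pairs, rods \<open>R\<close> and cables
  \<open>K\<close>. The last hypothesis prevents a rod from also being a cable in the opposite
  orientation.\<close>

lemma cabled_linkage_of_pairs:
  fixes R K :: "('v \<times> 'v) set" and l :: "'v \<Rightarrow> 'v \<Rightarrow> real" and \<mu> :: "'v \<Rightarrow> complex"
  assumes V: "finite V" "Fx \<subseteq> V"
    and pairs: "\<And>a b. (a, b) \<in> R \<union> K \<Longrightarrow> a \<in> V \<and> b \<in> V \<and> a \<noteq> b \<and> l a b > 0"
    and sym: "\<And>a b. l a b = l b a"
    and disj: "\<And>a b. (a, b) \<in> R \<Longrightarrow> (a, b) \<notin> K \<and> (b, a) \<notin> K"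
  obtains L :: "'v linkage_data" where "cabled_linkage L" "verts L = V"
    "config_space L = {\<phi> \<in> V \<rightarrow>\<^sub>E UNIV. (\<forall>v\<in>Fx. \<phi> v = \<mu> v) \<and>
       (\<forall>(a, b)\<in>K. cmod (\<phi> a - \<phi> b) \<le> l a b) \<and> (\<forall>(a, b)\<in>R. cmod (\<phi> a - \<phi> b) = l a b)}"
proof -
  define u where "u = (\<lambda>(a :: 'v, b). {a, b})"
  \<comment> \<open>Well defined on doubletons because \<open>l\<close> is symmetric.\<close>
  define ln where "ln e = (THE r. \<exists>a b. e = {a, b} \<and> r = l a b)" for e
  define L where "L = \<lparr>verts = V, edges = u ` (R \<union> K), len = ln, fixed = Fx, pos = \<mu>, flexible = u ` K\<rparr>"
  have ln: "ln {a, b} = l a b" for a b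
    unfolding ln_def by (rule the_equality) (auto simp: doubleton_eq_iff sym)
  have u: "{a, b} \<in> u ` S \<longleftrightarrow> (a, b) \<in> S \<or> (b, a) \<in> S" for a b S
    by (auto simp: u_def image_iff doubleton_eq_iff)
  have "cabled_linkage L"
    unfolding cabled_linkage_def
  proof (intro conjI)
    show "edges L \<subseteq> {{v, w} |v w. v \<in> verts L \<and> w \<in> verts L \<and> v \<noteq> w}"
      using pairs by (fastforce simp: L_def u_def)
    show "\<forall>e\<in>edges L. 0 < len L e"
      using pairs by (fastforce simp: L_def u_def ln)
  qed (use V in \<open>auto simp: L_def\<close>)
  moreover have "config_space L = {\<phi> \<in> V \<rightarrow>\<^sub>E UNIV. (\<forall>v\<in>Fx. \<phi> v = \<mu> v) \<and>
       (\<forall>(a, b)\<in>K. cmod (\<phi> a - \<phi> b) \<le> l a b) \<and> (\<forall>(a, b)\<in>R. cmod (\<phi> a - \<phi> b) = l a b)}"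
  proof -
    have 1: "(\<forall>v w. {v, w} \<in> flexible L \<longrightarrow> cmod (\<phi> v - \<phi> w) \<le> len L {v, w}) \<longleftrightarrow>
        (\<forall>(a, b)\<in>K. cmod (\<phi> a - \<phi> b) \<le> l a b)" for \<phi>
      using sym by (auto simp: L_def u ln norm_minus_commute)
    have "{v, w} \<in> edges L - flexible L \<longleftrightarrow> (v, w) \<in> R \<or> (w, v) \<in> R" for v w
      using disj by (auto simp: L_def u)
    then have 2: "(\<forall>v w. {v, w} \<in> edges L - flexible L \<longrightarrow> cmod (\<phi> v - \<phi> w) = len L {v, w}) \<longleftrightarrow>
        (\<forall>(a, b)\<in>R. cmod (\<phi> a - \<phi> b) = l a b)" for \<phi>
      using sym by (auto simp: L_def ln norm_minus_commute)
    show ?thesis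
      unfolding config_space_def 1 2 by (simp add: L_def)
  qed
  ultimately show ?thesis using that by (simp add: L_def)
qed

section \<open>From a parametrization to an analytic isomorphism\<close>

lemma mpoly_eval_coord:
  assumes "c \<noteq> 0"
  shows "mpoly_eval (Poly_Mapping.single (Poly_Mapping.single i 1) c) x = c * x i"
  using assms by (simp add: mpoly_eval_def monom_at_single[unfolded One_nat_def])

lemma admissible_real_analytic_fun:
  "openin (powertop_real I) U \<Longrightarrow> admissible_real I U f \<Longrightarrow> analytic_fun I U f"
  by (simp add: admissible_real_def series_analytic_imp)

text \<open>The inverse of the parametrization divides the real parts of the vertices below
  \<open>n\<close> by \<open>\<epsilon>\<close>; being linear it extends to the whole space, while
  \<open>\<Phi>\<close> itself supplies the analytic extension to \<open>U\<close>.\<close>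

lemma analytic_isomorphism_of_parametrization:
  fixes V :: "nat set" and \<Phi> :: "(nat \<Rightarrow> real) \<Rightarrow> nat \<Rightarrow> complex"
  assumes V: "{..<n} \<subseteq> V" and \<epsilon>: "\<epsilon> \<noteq> 0"
    and U: "openin (powertop_real {..<n}) U" "X \<subseteq> U"
    and ext: "\<And>x. x \<in> U \<Longrightarrow> \<Phi> x \<in> V \<rightarrow>\<^sub>E UNIV"
    and coord: "\<And>x i. x \<in> X \<Longrightarrow> i < n \<Longrightarrow> Re (\<Phi> x i) = \<epsilon> * x i"
    and good: "\<And>v. v \<in> V \<Longrightarrow> admissible_complex {..<n} U (\<lambda>x. \<Phi> x v)"
  shows "\<exists>f. polynomial_map (V <+> V) {..<n} f \<and>
    analytic_isomorphism (V <+> V) (real_coords V ` \<Phi> ` X) {..<n} X f"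
proof -
  let ?I = "{..<n}" and ?J = "V <+> V"
  define p where "p i = Poly_Mapping.single (Poly_Mapping.single (Inl i :: nat + nat) (1::nat)) (1 / \<epsilon>)" for i :: nat
  have p: "mpoly_eval (p i) y = 1 / \<epsilon> * y (Inl i)" for i y
    unfolding p_def by (rule mpoly_eval_coord) (use \<epsilon> in simp)
  define f where "f y = (\<lambda>i\<in>?I. mpoly_eval (p i) y)" for y
  define g where "g x = real_coords V (\<Phi> x)" for x
  have pf: "polynomial_map ?J ?I f"
    unfolding polynomial_map_def
    by (rule exI[of _ p]) (use V \<epsilon> in \<open>auto simp: f_def p_def mpoly_vars_def\<close>)
  have XT: "X \<subseteq> topspace (powertop_real ?I)"
    using U openin_subset by blast
  have gT: "g x \<in> topspace (powertop_real ?J)" for x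
    by (auto simp: g_def real_coords_def)
  have fg: "f (g x) = x" if "x \<in> X" for x
  proof
    fix i
    show "f (g x) i = x i"
    proof (cases "i < n")
      case True
      then show ?thesis using coord[OF that True] V \<epsilon> by (auto simp: f_def p g_def real_coords_def)
    next
      case False
      then show ?thesis using XT that by (auto simp: f_def PiE_def extensional_def)
    qed
  qed
  have gg: "admissible_real ?I U (\<lambda>x. g x j)" if "j \<in> ?J" for j
    using that good by (auto simp: g_def real_coords_def admissible_complex_def)
  have fr: "admissible_real ?J S (\<lambda>y. f y i)" if "i < n" for S i
  proof -
    have "admissible_real ?J S (\<lambda>y. 1 / \<epsilon> * y (Inl i))"
      by (intro admissible_real_mult admissible_real_const admissible_real_coord) (use V that in auto)
    then show ?thesis using that by (simp add: f_def p)
  qed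
  let ?X = "subtopology (powertop_real ?I) X" and ?C = "subtopology (powertop_real ?J) (g ` X)"
  have "homeomorphic_maps ?C ?X f g"
    unfolding homeomorphic_maps_def
  proof (intro conjI)
    show "continuous_map ?C ?X f"
      unfolding continuous_map_in_subtopology
    proof
      show "continuous_map ?C (powertop_real ?I) f"
        unfolding continuous_map_componentwise
        using fr[of _ "g ` X"] by (auto simp: admissible_real_def f_def)
    qed (use fg in auto)
    have "continuous_map (subtopology (powertop_real ?I) U) (powertop_real ?J) g"
      unfolding continuous_map_componentwise
      using gg by (auto simp: admissible_real_def g_def real_coords_def)
    then show "continuous_map ?X ?C g"
      unfolding continuous_map_in_subtopology
      using U(2) continuous_map_from_subtopology_mono by auto
  qed (use fg in auto)
  moreover have "restriction_of_analytic ?J (g ` X) ?I f"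
    unfolding restriction_of_analytic_def analytic_map_def
  proof (intro exI conjI ballI)
    show "g ` X \<subseteq> topspace (powertop_real ?J)" using gT by blast
    show "openin (powertop_real ?J) (topspace (powertop_real ?J))"
      by (rule openin_topspace)
    show "f ` topspace (powertop_real ?J) \<subseteq> topspace (powertop_real ?I)"
      by (auto simp: f_def split: if_splits)
    show "analytic_fun ?J (topspace (powertop_real ?J)) (\<lambda>y. f y i)" if "i \<in> ?I" for i
      by (rule admissible_real_analytic_fun[OF openin_topspace fr]) (use that in simp)
  qed auto
  moreover have "restriction_of_analytic ?I X ?J g"
    unfolding restriction_of_analytic_def analytic_map_def
  proof (intro exI conjI ballI)
    show "g ` U \<subseteq> topspace (powertop_real ?J)" using gT by blast
    show "analytic_fun ?I U (\<lambda>x. g x j)" if "j \<in> ?J" for j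
      by (rule admissible_real_analytic_fun[OF U(1) gg[OF that]])
  qed (use U in auto)
  ultimately have "analytic_isomorphism ?J (g ` X) ?I X f"
    unfolding analytic_isomorphism_def using XT gT by blast
  moreover have "g ` X = real_coords V ` \<Phi> ` X"
    by (auto simp: g_def)
  ultimately show ?thesis using pf by auto
qed

section \<open>Homogenized polynomials and sign conditions\<close>

definition total_degree :: "('i \<Rightarrow>\<^sub>0 nat) \<Rightarrow> nat" where
  "total_degree m = (\<Sum>i\<in>Poly_Mapping.keys m. Poly_Mapping.lookup m i)"

text \<open>The default 0 beyond index \<open>n\<close> agrees with that of \<open>trunc\<close> for
  \<open>Suc n\<close> inputs, so that the two can be equal as functions.\<close>

definition scaled_point :: "nat \<Rightarrow> real \<Rightarrow> (nat \<Rightarrow> real) \<Rightarrow> nat \<Rightarrow> complex" where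
  "scaled_point n \<epsilon> x = (\<lambda>i. if i < n then of_real (\<epsilon> * x i) else if i = n then of_real \<epsilon> else 0)"

text \<open>
  The variable \<open>n\<close> homogenizes. The exponent is at least 1 when \<open>d\<close> bounds the degree of \<open>q\<close>,
  which puts the germ at 0 for \<open>z = 0\<close>.
\<close>

definition homogenize :: "nat \<Rightarrow> nat \<Rightarrow> nat mpoly \<Rightarrow> (nat \<Rightarrow> complex) \<Rightarrow> complex" where
  "homogenize n d q z = (\<Sum>m\<in>Poly_Mapping.keys q. of_real (Poly_Mapping.lookup q m) *
     (z n ^ (Suc d - total_degree m) * (\<Prod>i\<in>Poly_Mapping.keys m. z i ^ Poly_Mapping.lookup m i)))"

text \<open>Homogeneity of degree \<open>Suc d\<close>. For \<open>\<epsilon> > 0\<close> the extra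
  factor is positive, so signs of \<open>q\<close> at \<open>x\<close> can be tested at the small
  scaled point.\<close>

lemma homogenize_scaled_point:
  assumes vars: "mpoly_vars q \<subseteq> {..<n}" and d: "\<And>m. m \<in> Poly_Mapping.keys q \<Longrightarrow> total_degree m \<le> d"
  shows "homogenize n d q (scaled_point n \<epsilon> x) = of_real (\<epsilon> ^ Suc d * mpoly_eval q x)"
proof -
  have "of_real (Poly_Mapping.lookup q m) * (scaled_point n \<epsilon> x n ^ (Suc d - total_degree m) *
      (\<Prod>i\<in>Poly_Mapping.keys m. scaled_point n \<epsilon> x i ^ Poly_Mapping.lookup m i))
      = (of_real (\<epsilon> ^ Suc d * (Poly_Mapping.lookup q m * monom_at m x)) :: complex)"
    if m: "m \<in> Poly_Mapping.keys q" for m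
  proof -
    have "scaled_point n \<epsilon> x i = of_real (\<epsilon> * x i)" if "i \<in> Poly_Mapping.keys m" for i
      using that m vars by (fastforce simp: scaled_point_def mpoly_vars_def)
    then have "(\<Prod>i\<in>Poly_Mapping.keys m. scaled_point n \<epsilon> x i ^ Poly_Mapping.lookup m i)
        = (\<Prod>i\<in>Poly_Mapping.keys m. of_real (\<epsilon> * x i) ^ Poly_Mapping.lookup m i)"
      by (intro prod.cong) auto
    also have "\<dots> = of_real (\<epsilon> ^ total_degree m * monom_at m x)"
      by (simp add: monom_at_def total_degree_def power_mult_distrib prod.distrib power_sum)
    finally have *: "(\<Prod>i\<in>Poly_Mapping.keys m. scaled_point n \<epsilon> x i ^ Poly_Mapping.lookup m i)
        = of_real (\<epsilon> ^ total_degree m * monom_at m x)" .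
    have "\<epsilon> ^ Suc d = \<epsilon> ^ (Suc d - total_degree m) * \<epsilon> ^ total_degree m"
      using d[OF m] by (simp flip: power_add del: power_Suc)
    moreover have "scaled_point n \<epsilon> x n = of_real \<epsilon>"
      by (simp add: scaled_point_def)
    ultimately show ?thesis unfolding * by simp
  qed
  then have "homogenize n d q (scaled_point n \<epsilon> x)
      = (\<Sum>m\<in>Poly_Mapping.keys q. of_real (\<epsilon> ^ Suc d * (Poly_Mapping.lookup q m * monom_at m x)))"
    unfolding homogenize_def by (intro sum.cong) auto
  then show ?thesis
    by (simp add: mpoly_eval_def sum_distrib_left)
qed

lemma homogenize_zero:
  assumes "\<And>m. m \<in> Poly_Mapping.keys q \<Longrightarrow> total_degree m \<le> d"
  shows "homogenize n d q (\<lambda>_. 0) = 0"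
  unfolding homogenize_def
proof (rule sum.neutral, rule ballI)
  fix m assume "m \<in> Poly_Mapping.keys q"
  then have "Suc d - total_degree m > 0" using assms by (simp add: Suc_diff_le)
  then show "of_real (Poly_Mapping.lookup q m) * ((0::complex) ^ (Suc d - total_degree m) *
      (\<Prod>i\<in>Poly_Mapping.keys m. 0 ^ Poly_Mapping.lookup m i)) = 0"
    by simp
qed

lemma (in parametrized_linkage) computable_homogenize:
  assumes "n < N" "mpoly_vars q \<subseteq> {..<n}"
  shows "computable (homogenize n d q)"
proof -
  have "i < N" if "m \<in> Poly_Mapping.keys q" "i \<in> Poly_Mapping.keys m" for m i
    using that assms by (fastforce simp: mpoly_vars_def)
  then show ?thesis
    unfolding homogenize_def
    by (intro computable_sum computable_mult computable_const computable_power computable_prod computable_input)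
      (use assms in auto)
qed

text \<open>An equation becomes two opposite inequalities, so only signs are tested.
  \<open>H\<close> is obtained before \<open>\<epsilon>\<close>. Reality at scaled points matters
  because the final cable tests the sign of \<open>f\<close> by a disc, which a complex value with
  nonnegative real part could miss.\<close>

lemma (in parametrized_linkage) quasialgebraic_germs:
  assumes X: "quasialgebraic {..<n} X" and n: "n < N"
  shows "\<exists>H. finite H \<and> (\<forall>f\<in>H. computable f \<and> f origin = 0 \<and> (\<forall>\<epsilon> x. f (scaled_point n \<epsilon> x) \<in> \<real>)) \<and>
    (\<forall>\<epsilon>>0. \<forall>x\<in>topspace (powertop_real {..<n}).
       x \<in> X \<longleftrightarrow> (\<forall>f\<in>H. Re (f (scaled_point n \<epsilon> x)) \<ge> 0))"
proof -
  obtain P Q :: "nat mpoly set" where PQ: "finite P" "finite Q" "\<And>p. p \<in> P \<union> Q \<Longrightarrow> mpoly_vars p \<subseteq> {..<n}"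
    and X: "X = {x \<in> topspace (powertop_real {..<n}).
               (\<forall>p\<in>P. mpoly_eval p x = 0) \<and> (\<forall>q\<in>Q. mpoly_eval q x \<ge> 0)}"
    using X unfolding quasialgebraic_def by blast
  \<comment> \<open>A crude bound on the degree of every monomial of \<open>q\<close>.\<close>
  define d where "d q = (\<Sum>m\<in>Poly_Mapping.keys q. total_degree m)" for q :: "nat mpoly"
  have d: "total_degree m \<le> d q" if "m \<in> Poly_Mapping.keys q" for m q
    unfolding d_def by (rule member_le_sum) (use that in auto)
  define G where "G s q z = of_real s * homogenize n (d q) q z" for s :: real and q z
  define H where "H = G 1 ` (P \<union> Q) \<union> G (-1) ` P"
  have ev: "G s q (scaled_point n \<epsilon> x) = of_real (s * \<epsilon> ^ Suc (d q) * mpoly_eval q x)"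
    if "q \<in> P \<union> Q" for s q \<epsilon> x
    using homogenize_scaled_point[of q n "d q" \<epsilon> x] PQ(3)[OF that] d by (simp add: G_def)
  show ?thesis
  proof (intro exI[of _ H] conjI ballI allI impI)
    show "finite H" using PQ by (simp add: H_def)
    show "computable f" if "f \<in> H" for f
    proof -
      from that have "\<exists>s q. f = G s q \<and> q \<in> P \<union> Q" unfolding H_def by blast
      then obtain s q where "f = G s q" "q \<in> P \<union> Q" by blast
      then show ?thesis
        using PQ(3) n by (auto simp: G_def[abs_def] intro!: computable_scale computable_homogenize)
    qed
    show "f origin = 0" if "f \<in> H" for f
      using that d by (auto simp: H_def G_def homogenize_zero)
    show "f (scaled_point n \<epsilon> x) \<in> \<real>" if "f \<in> H" for f \<epsilon> x
    proof -
      from that have "\<exists>s q. f = G s q \<and> q \<in> P \<union> Q" unfolding H_def by blast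
      then obtain s q where "f = G s q" "q \<in> P \<union> Q" by blast
      then show ?thesis using ev by (metis Reals_of_real)
    qed
    fix x \<epsilon> assume \<epsilon>: "(\<epsilon>::real) > 0" and x: "x \<in> topspace (powertop_real {..<n})"
    have sgn: "Re (G 1 q (scaled_point n \<epsilon> x)) \<ge> 0 \<longleftrightarrow> mpoly_eval q x \<ge> 0"
      "Re (G (-1) q (scaled_point n \<epsilon> x)) \<ge> 0 \<longleftrightarrow> mpoly_eval q x \<le> 0" if "q \<in> P \<union> Q" for q
    proof -
      have pos: "0 \<le> c * v \<longleftrightarrow> 0 \<le> v" if "c > 0" for c v :: real
        using that by (auto simp: zero_le_mult_iff)
      show "Re (G 1 q (scaled_point n \<epsilon> x)) \<ge> 0 \<longleftrightarrow> mpoly_eval q x \<ge> 0"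
        "Re (G (-1) q (scaled_point n \<epsilon> x)) \<ge> 0 \<longleftrightarrow> mpoly_eval q x \<le> 0"
        using pos[OF zero_less_power[OF \<epsilon>], of "Suc (d q)" "mpoly_eval q x"]
          pos[OF zero_less_power[OF \<epsilon>], of "Suc (d q)" "- mpoly_eval q x"]
        unfolding ev[OF that] by (simp_all del: power_Suc)
    qed
    show "x \<in> X \<longleftrightarrow> (\<forall>f\<in>H. Re (f (scaled_point n \<epsilon> x)) \<ge> 0)"
      using x sgn unfolding X H_def by (auto simp: ball_Un intro: antisym)
  qed
qed

text \<open>Inversion of power 2 about \<open>- \<i>\<close> sends the real line, at distance 1 from
  the centre, to a circle through the centre of diameter 2: the unit circle about 0. The centre is
  excluded because division by zero would return \<open>- \<i>\<close>, a point of that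
  circle.\<close>

lemma norm_inversion_line:
  assumes "z \<noteq> - \<i>"
  shows "cmod (- \<i> + of_real 2 / cnj (z - - \<i>)) = 1 \<longleftrightarrow> Im z = 0"
proof -
  define u where "u = z + \<i>"
  have u: "u \<noteq> 0" using assms by (simp add: u_def add_eq_0_iff2)
  have e: "- \<i> + of_real 2 / cnj (z - - \<i>) = (2 - \<i> * cnj u) / cnj u"
    using u by (simp add: u_def[symmetric] diff_divide_distrib)
  have "cmod (- \<i> + of_real 2 / cnj (z - - \<i>)) = 1 \<longleftrightarrow> cmod (2 - \<i> * cnj u) = cmod u"
    unfolding e norm_divide complex_mod_cnj using u by auto
  also have "\<dots> \<longleftrightarrow> (cmod (2 - \<i> * cnj u))\<^sup>2 = (cmod u)\<^sup>2"
    by simp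
  also have "\<dots> \<longleftrightarrow> Im u = 1"
    unfolding cmod_power2 by (auto simp: power2_eq_square algebra_simps)
  finally show ?thesis by (simp add: u_def)
qed

lemma compactin_powertop_bounded:
  assumes "finite I" "compactin (powertop_real I) X"
  obtains R where "R > 0" "\<And>x i. x \<in> X \<Longrightarrow> i \<in> I \<Longrightarrow> \<bar>x i\<bar> < R"
proof -
  have "\<exists>r. \<forall>x\<in>X. \<bar>x i\<bar> \<le> r" if "i \<in> I" for i
  proof -
    have "compactin euclideanreal ((\<lambda>x. x i) ` X)"
      by (rule image_compactin[OF assms(2)]) (use that in \<open>auto intro: continuous_map_product_projection\<close>)
    then have "bounded ((\<lambda>x. x i) ` X)"
      by (simp add: compact_imp_bounded)
    then show ?thesis by (auto simp: bounded_iff)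
  qed
  then obtain r where r: "\<And>i x. i \<in> I \<Longrightarrow> x \<in> X \<Longrightarrow> \<bar>x i\<bar> \<le> r i"
    by metis
  show ?thesis
  \<comment> \<open>The 1 makes the bounds strict, so that \<open>X\<close> fits into an open box,
    and positive even for empty \<open>I\<close>.\<close>
  proof (rule that[of "1 + (\<Sum>i\<in>I. \<bar>r i\<bar>)"])
    show "0 < 1 + (\<Sum>i\<in>I. \<bar>r i\<bar>)"
      by (intro add_pos_nonneg sum_nonneg) auto
    fix x i assume "x \<in> X" "i \<in> I"
    then have "\<bar>x i\<bar> \<le> \<bar>r i\<bar>" using r[of i x] by linarith
    also have "\<dots> \<le> (\<Sum>i\<in>I. \<bar>r i\<bar>)"
      by (rule member_le_sum) (use \<open>i \<in> I\<close> assms(1) in auto)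
    finally show "\<bar>x i\<bar> < 1 + (\<Sum>i\<in>I. \<bar>r i\<bar>)" by simp
  qed
qed

section \<open>Assembly of the linkage and its configuration space\<close>

theorem theorem3:
  fixes n :: nat and X :: "(nat \<Rightarrow> real) set"
  assumes "quasialgebraic {..<n} X"
    and "compactin (powertop_real {..<n}) X"
  shows "\<exists>L :: nat linkage_data. cabled_linkage L \<and>
    (\<exists>f. polynomial_map (verts L <+> verts L) {..<n} f \<and>
         analytic_isomorphism (verts L <+> verts L) (real_coords (verts L) ` config_space L)
           {..<n} X f)"
proof -
  \<comment> \<open>One input per coordinate, and the homogenizing input at index
    \<open>n\<close>.\<close>
  interpret parametrized_linkage "Suc n" "{..<n}" .
  obtain H where H1: "finite H"
    and H2: "\<forall>f\<in>H. computable f \<and> f origin = 0 \<and> (\<forall>\<epsilon> x. f (scaled_point n \<epsilon> x) \<in> \<real>)"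
    and H3: "\<forall>\<epsilon>>0. \<forall>x\<in>topspace (powertop_real {..<n}).
       x \<in> X \<longleftrightarrow> (\<forall>f\<in>H. Re (f (scaled_point n \<epsilon> x)) \<ge> 0)"
    using quasialgebraic_germs[OF assms(1) lessI] by (elim exE conjE)
  have H: "finite H" "\<And>f. f \<in> H \<Longrightarrow> computable f" "\<And>f. f \<in> H \<Longrightarrow> f origin = 0"
    and HR: "\<And>f \<epsilon> x. f \<in> H \<Longrightarrow> f (scaled_point n \<epsilon> x) \<in> \<real>"
    using H1 H2 by simp_all
  have HX: "\<And>x \<epsilon>. \<epsilon> > 0 \<Longrightarrow> x \<in> topspace (powertop_real {..<n}) \<Longrightarrow>
       x \<in> X \<longleftrightarrow> (\<forall>f\<in>H. Re (f (scaled_point n \<epsilon> x)) \<ge> 0)"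
    using H3 by simp
  define w where "w i z = - \<i> + of_real 2 / cnj (z i - - \<i>)" for i and z :: "nat \<Rightarrow> complex"
  have w: "constructible (w i)" if "i < n" for i
    unfolding w_def by (rule constructible_inversion[OF constructible_input]) (use that in auto)
  have "realizable (w ` {..<n} \<union> H)"
    by (rule realizable_finite) (use H w in \<open>auto simp: computable_def\<close>)
  then obtain k h E F where S: "system k h E F"
    and real: "\<forall>f\<in>w ` {..<n} \<union> H. \<exists>j<k. \<forall>\<^sub>F z in germ. h j z = f z"
    unfolding realizable_def by blast
  from bchoice[OF real] obtain J where J: "\<And>f. f \<in> w ` {..<n} \<union> H \<Longrightarrow> J f < k"
    "\<And>f. f \<in> w ` {..<n} \<union> H \<Longrightarrow> \<forall>\<^sub>F z in germ. h (J f) z = f z"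
    by blast
  have k: "Suc n \<le> k" and inp: "\<And>i. i \<le> n \<Longrightarrow> h i = (\<lambda>z. z i)" and F: "F \<subseteq> {Suc n..<k}"
    and hF: "\<And>j z. j \<in> F \<Longrightarrow> h j z = h j origin" and reg: "\<And>j. j < k \<Longrightarrow> regular (h j)"
    and E: "\<And>a b. (a, b) \<in> E \<Longrightarrow> a < k \<and> b < k \<and> h a origin \<noteq> h b origin"
    using S unfolding system_def by (blast, simp add: less_Suc_eq_le, blast, blast, blast, blast)
  have rigE: "\<forall>\<^sub>F z in germ. \<forall>(a, b)\<in>E. cmod (h a z - h b z) = cmod (h a origin - h b origin)"
    using S unfolding system_def by blast
  obtain \<delta>0 where \<delta>0: "\<delta>0 > 0" "\<And>\<phi>. \<forall>j<k. cmod (\<phi> j - h j origin) < \<delta>0 \<Longrightarrow>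
        \<forall>j\<in>F. \<phi> j = h j origin \<Longrightarrow>
        \<forall>(a, b)\<in>E. cmod (\<phi> a - \<phi> b) = cmod (h a origin - h b origin) \<Longrightarrow>
        \<forall>j<k. \<phi> j = h j (trunc \<phi>)"
    using S unfolding system_def by blast
  have "\<forall>\<^sub>F z in germ. \<forall>f\<in>w ` {..<n} \<union> H. h (J f) z = f z"
    using J(2) H(1) by (intro eventually_ball_finite) auto
  then obtain e0 where e0: "e0 > 0"
    "\<And>z f. \<forall>i<Suc n. cmod (z i) < e0 \<Longrightarrow> f \<in> w ` {..<n} \<union> H \<Longrightarrow> h (J f) z = f z"
    unfolding eventually_germ by blast
  have hJ0: "h (J f) origin = 0" if "f \<in> H" for f
    using e0 that H(3) by auto
  \<comment> \<open>The cable length. Below \<open>\<delta>0\<close> positions are unique, below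
    \<open>e0\<close> the chosen vertices carry the desired functions, and below 1 the inputs avoid
    the centre \<open>- \<i>\<close>. Halving gives the strict inequalities, since a cable only
    yields \<le>.\<close>
  define \<delta> where "\<delta> = min (min \<delta>0 e0) 1 / 2"
  have \<delta>: "0 < \<delta>" "\<delta> < \<delta>0" "\<delta> < e0" "\<delta> < 1"
    using \<delta>0(1) e0(1) by (auto simp: \<delta>_def min_def)
  have "\<exists>e>0. preserves e (h j)" if "j < k" for j
    using reg[OF that] by (simp add: regular_def)
  then obtain e1 where e1: "\<And>j. j < k \<Longrightarrow> e1 j > 0" "\<And>j. j < k \<Longrightarrow> preserves (e1 j) (h j)"
    by metis
  \<comment> \<open>Continuity at the origin: inputs below \<open>e2\<close> keep every base cable
    slack and every rod at its length.\<close>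
  have "\<forall>\<^sub>F z in germ. \<forall>j\<in>{..<k}. cmod (h j z - h j origin) < \<delta>"
    using regular_tendsto[OF reg] \<delta>(1) by (intro eventually_ball_finite) (auto simp: tendsto_iff dist_norm)
  from eventually_conj[OF this rigE]
  obtain e2 where e2: "e2 > 0"
    "\<And>z j. \<forall>i<Suc n. cmod (z i) < e2 \<Longrightarrow> j < k \<Longrightarrow> cmod (h j z - h j origin) < \<delta>"
    "\<And>z a b. \<forall>i<Suc n. cmod (z i) < e2 \<Longrightarrow> (a, b) \<in> E \<Longrightarrow>
       cmod (h a z - h b z) = cmod (h a origin - h b origin)"
    unfolding eventually_germ by fast
  \<comment> \<open>Chosen after \<open>\<delta>\<close>; the radii \<open>e1 j\<close> make the
    substitution of analytic inputs into \<open>h j\<close> legitimate.\<close>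
  define \<eta> where "\<eta> = Min (insert (min (min e0 e2) 1) (e1 ` {..<k}))"
  have \<eta>: "\<eta> > 0" "\<eta> \<le> e0" "\<eta> \<le> e2" "\<eta> \<le> 1" "\<And>j. j < k \<Longrightarrow> \<eta> \<le> e1 j"
  proof -
    show "\<eta> > 0" unfolding \<eta>_def using e0(1) e2(1) e1(1) by (subst Min_gr_iff) auto
    have "\<eta> \<le> min (min e0 e2) 1" unfolding \<eta>_def by (rule Min_le) auto
    then show "\<eta> \<le> e0" "\<eta> \<le> e2" "\<eta> \<le> 1" by auto
    show "\<eta> \<le> e1 j" if "j < k" for j unfolding \<eta>_def by (rule Min_le) (use that in auto)
  qed
  obtain R where R: "R > 0" "\<And>x i. x \<in> X \<Longrightarrow> i < n \<Longrightarrow> \<bar>x i\<bar> < R"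
    using compactin_powertop_bounded[OF _ assms(2)] by auto
  \<comment> \<open>The denominator exceeds both 1 and \<open>R\<close>, so the homogenizing input
    \<open>\<epsilon>\<close> and the scaled coordinates all stay below
    \<open>\<eta>\<close>.\<close>
  define \<epsilon> where "\<epsilon> = \<eta> / (R + 1)"
  have \<epsilon>: "\<epsilon> > 0" "\<epsilon> < \<eta>" "\<epsilon> * R < \<eta>"
    using \<eta>(1) R(1) by (auto simp: \<epsilon>_def field_simps)
  define Z where "Z = scaled_point n \<epsilon>"
  define U where "U = PiE {..<n} (\<lambda>_. {-R<..<R})"
  have oU: "openin (powertop_real {..<n}) U"
    unfolding U_def by (simp add: openin_PiE_gen)
  have XT: "X \<subseteq> topspace (powertop_real {..<n})"
    using assms(2) compactin_subset_topspace by blast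
  have XU: "X \<subseteq> U"
  proof
    fix x assume "x \<in> X"
    then show "x \<in> U" using XT R(2)[of x] by (fastforce simp: U_def PiE_iff abs_less_iff)
  qed
  have Zsmall: "cmod (Z x i) < \<eta>" if "x \<in> U" for x i
  proof -
    have "\<bar>\<epsilon> * x i\<bar> < \<eta>" if "i < n"
    proof -
      have "x i \<in> {-R<..<R}"
        by (rule PiE_mem[where S="{..<n}"]) (use \<open>x \<in> U\<close> that in \<open>simp_all add: U_def\<close>)
      then have "\<bar>x i\<bar> \<le> R" by auto
      then have "\<epsilon> * \<bar>x i\<bar> \<le> \<epsilon> * R" using \<epsilon>(1) by (intro mult_left_mono) auto
      moreover have "\<bar>\<epsilon> * x i\<bar> = \<epsilon> * \<bar>x i\<bar>" using \<epsilon>(1) by (simp add: abs_mult)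
      ultimately show ?thesis using \<epsilon>(3) by linarith
    qed
    moreover have "\<bar>\<epsilon>\<bar> < \<eta>" using \<epsilon>(1,2) by linarith
    ultimately show ?thesis
      using \<eta>(1) by (simp only: Z_def scaled_point_def norm_of_real split: if_split) simp
  qed
  \<comment> \<open>Vertices below \<open>k\<close> form the system; \<open>k + j\<close> anchors
    the cable of \<open>j\<close> at its base position; \<open>2 * k\<close> at 0 is the centre of
    the unit circle tested by \<open>w\<close>, and \<open>2 * k + 1\<close> at 1 that of the disc
    testing signs.\<close>
  define V where "V = {..<2 * k + 2}"
  \<comment> \<open>The branch for \<open>n\<close> comes first: this input is pinned at
    \<open>\<epsilon>\<close>, not at its base position 0.\<close>
  define p where "p v = (if v = n then of_real \<epsilon> else if v < k then h v origin
      else if v < 2 * k then h (v - k) origin else if v = 2 * k then 0 else 1)" for v :: nat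
  define Fx where "Fx = insert n (F \<union> {k..<2 * k + 2})"
  define Rd where "Rd = E \<union> (\<lambda>i. (J (w i), 2 * k)) ` {..<n}"
  define Kb where "Kb = (\<lambda>j. (j, k + j)) ` {..<k} \<union> (\<lambda>f. (J f, 2 * k + 1)) ` H"
  define l where "l a b = (if a \<ge> 2 * k \<or> b \<ge> 2 * k then 1 else if a \<ge> k \<or> b \<ge> k then \<delta>
      else cmod (h a origin - h b origin))" for a b
  obtain L :: "nat linkage_data" where L: "cabled_linkage L" "verts L = V"
    and config: "config_space L = {\<phi> \<in> V \<rightarrow>\<^sub>E UNIV. (\<forall>v\<in>Fx. \<phi> v = p v) \<and>
       (\<forall>(a, b)\<in>Kb. cmod (\<phi> a - \<phi> b) \<le> l a b) \<and> (\<forall>(a, b)\<in>Rd. cmod (\<phi> a - \<phi> b) = l a b)}"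
  proof (rule cabled_linkage_of_pairs[of V Fx Rd Kb l p])
    show "finite V" by (simp add: V_def)
    show "Fx \<subseteq> V" using F k by (auto simp: Fx_def V_def)
    show "a \<in> V \<and> b \<in> V \<and> a \<noteq> b \<and> 0 < l a b" if "(a, b) \<in> Rd \<union> Kb" for a b
    proof -
      have "J (w i) < k" if "i < n" for i using that J(1) by auto
      moreover have "J f < k" if "f \<in> H" for f using that J(1) by auto
      ultimately show ?thesis
        using that E[of a b] \<delta>(1) by (fastforce simp: Rd_def Kb_def V_def l_def)
    qed
    show "l a b = l b a" for a b by (auto simp: l_def norm_minus_commute)
    show "(a, b) \<notin> Kb \<and> (b, a) \<notin> Kb" if "(a, b) \<in> Rd" for a b
    proof -
      have "J (w i) < k" if "i < n" for i using that J(1) by auto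
      moreover have "J f < k" if "f \<in> H" for f using that J(1) by auto
      ultimately show ?thesis
        using that E[of a b] by (fastforce simp: Rd_def Kb_def)
    qed
  qed blast
  define \<Phi> where "\<Phi> x = (\<lambda>v\<in>V. if v < k then h v (Z x) else p v)" for x
  have "config_space L = \<Phi> ` X"
  proof (intro equalityI subsetI)
    fix \<phi> assume "\<phi> \<in> config_space L"
    then have ext: "\<phi> \<in> V \<rightarrow>\<^sub>E UNIV" and fx: "\<And>v. v \<in> Fx \<Longrightarrow> \<phi> v = p v"
      and kb: "\<And>a b. (a, b) \<in> Kb \<Longrightarrow> cmod (\<phi> a - \<phi> b) \<le> l a b"
      and rd: "\<And>a b. (a, b) \<in> Rd \<Longrightarrow> cmod (\<phi> a - \<phi> b) = l a b"
      unfolding config by blast+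
    have near: "cmod (\<phi> j - h j origin) \<le> \<delta>" if "j < k" for j
    proof -
      have "cmod (\<phi> j - \<phi> (k + j)) \<le> l j (k + j)"
        by (rule kb) (use that in \<open>simp add: Kb_def\<close>)
      moreover have "\<phi> (k + j) = p (k + j)" by (rule fx) (use that in \<open>simp add: Fx_def\<close>)
      ultimately show ?thesis using that k by (simp add: l_def p_def)
    qed
    \<comment> \<open>The cables supply the closeness under which the uniqueness clause leaves only
      the parametrized position.\<close>
    have sys: "\<phi> j = h j (trunc \<phi>)" if "j < k" for j
    proof -
      have "\<forall>j<k. \<phi> j = h j (trunc \<phi>)"
      proof (rule \<delta>0(2))
        show "\<forall>j<k. cmod (\<phi> j - h j origin) < \<delta>0" using near \<delta> by fastforce
        show "\<forall>j\<in>F. \<phi> j = h j origin"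
        proof
          fix j assume "j \<in> F"
          then show "\<phi> j = h j origin" using fx[of j] F by (auto simp: Fx_def p_def)
        qed
        show "\<forall>(a, b)\<in>E. cmod (\<phi> a - \<phi> b) = cmod (h a origin - h b origin)"
        proof clarify
          fix a b assume "(a, b) \<in> E"
          then show "cmod (\<phi> a - \<phi> b) = cmod (h a origin - h b origin)"
            using rd[of a b] E[of a b] by (simp add: Rd_def l_def)
        qed
      qed
      then show ?thesis using that by blast
    qed
    have small: "cmod (\<phi> i) \<le> \<delta>" if "i < Suc n" for i
      using near[of i] k inp[of i] that by simp
    then have ts: "\<forall>i<Suc n. cmod (trunc \<phi> i) < e0"
      using \<delta>(3) by (fastforce simp: trunc_def)
    \<comment> \<open>The rod of length 1 keeps the inverted input on the unit circle, hence the
      input on the real line.\<close>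
    have line: "Im (\<phi> i) = 0" if i: "i < n" for i
    proof -
      have "cmod (\<phi> (J (w i)) - \<phi> (2 * k)) = l (J (w i)) (2 * k)"
        by (rule rd) (use i in \<open>simp add: Rd_def\<close>)
      moreover have "\<phi> (2 * k) = 0" using fx[of "2 * k"] k by (simp add: Fx_def p_def)
      moreover have "\<phi> (J (w i)) = w i (trunc \<phi>)"
        using sys[of "J (w i)"] J(1)[of "w i"] e0(2)[OF ts, of "w i"] i by auto
      ultimately have "cmod (w i (trunc \<phi>)) = 1" by (simp add: l_def)
      moreover have "trunc \<phi> i \<noteq> - \<i>"
        using small[of i] \<delta>(4) i by (auto simp: trunc_def)
      ultimately have "Im (trunc \<phi> i) = 0"
        unfolding w_def by (subst (asm) norm_inversion_line) auto
      then show ?thesis using i by (simp add: trunc_def)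
    qed
    define x where "x = (\<lambda>i\<in>{..<n}. Re (\<phi> i) / \<epsilon>)"
    have xT: "x \<in> topspace (powertop_real {..<n})" by (simp add: x_def)
    have "\<phi> n = of_real \<epsilon>" using fx[of n] by (simp add: Fx_def p_def)
    \<comment> \<open>With real inputs and the last one equal to \<open>\<epsilon>\<close>, the
      inputs form a scaled point.\<close>
    then have Zx: "trunc \<phi> = Z x"
      using line \<epsilon>(1) by (auto simp: trunc_def Z_def scaled_point_def x_def fun_eq_iff complex_eq_iff)
    have "x \<in> X"
    proof (subst HX[OF \<epsilon>(1) xT], intro ballI)
      fix f assume f: "f \<in> H"
      have "cmod (\<phi> (J f) - \<phi> (2 * k + 1)) \<le> l (J f) (2 * k + 1)"
        by (rule kb) (use f in \<open>simp add: Kb_def\<close>)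
      moreover have "\<phi> (2 * k + 1) = 1" using fx[of "2 * k + 1"] k by (simp add: Fx_def p_def)
      moreover have "\<phi> (J f) = f (Z x)"
        using sys[of "J f"] J(1)[of f] e0(2)[OF ts, of f] f by (auto simp: Zx)
      \<comment> \<open>The disc of radius 1 about 1 lies in the closed right half plane.\<close>
      ultimately have "cmod (f (Z x) - 1) \<le> 1" by (simp add: l_def)
      then have "\<bar>Re (f (Z x) - 1)\<bar> \<le> 1" using abs_Re_le_cmod order_trans by blast
      then show "0 \<le> Re (f (scaled_point n \<epsilon> x))" by (simp add: Z_def)
    qed
    moreover have "\<phi> = \<Phi> x"
    proof
      fix v
      show "\<phi> v = \<Phi> x v"
      proof (cases "v \<in> V")
        case True
        then show ?thesis using sys[of v] fx[of v] by (auto simp: \<Phi>_def Zx Fx_def V_def)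
      next
        case False
        then show ?thesis using ext by (auto simp: \<Phi>_def PiE_iff extensional_def)
      qed
    qed
    ultimately show "\<phi> \<in> \<Phi> ` X" by blast
  next
    fix \<phi> assume "\<phi> \<in> \<Phi> ` X"
    then obtain x where x: "x \<in> X" "\<phi> = \<Phi> x" by blast
    have Zs: "\<forall>i<Suc n. cmod (Z x i) < \<eta>" using Zsmall x(1) XU by blast
    then have Z0: "\<forall>i<Suc n. cmod (Z x i) < e0" and Z2: "\<forall>i<Suc n. cmod (Z x i) < e2"
      using \<eta>(2,3) by fastforce+
    have \<phi>h: "\<phi> v = h v (Z x)" if "v < k" for v
      using that by (simp add: x(2) \<Phi>_def V_def)
    have \<phi>p: "\<phi> v = p v" if "v \<ge> k" "v < 2 * k + 2" for v
      using that by (simp add: x(2) \<Phi>_def V_def)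
    have \<phi>J: "\<phi> (J f) = f (Z x)" if "f \<in> w ` {..<n} \<union> H" for f
      using \<phi>h J(1)[OF that] e0(2)[OF Z0 that] by simp
    have "\<phi> v = p v" if v: "v \<in> Fx" for v
    proof -
      consider "v = n" | "v \<in> F" | "v \<ge> k" "v < 2 * k + 2"
        using v by (auto simp: Fx_def)
      then show ?thesis
      proof cases
        case 1
        then show ?thesis using \<phi>h[of n] k inp[of n] by (simp add: p_def Z_def scaled_point_def)
      next
        case 2
        then have v: "v < k" "v \<noteq> n" using F by auto
        then show ?thesis using \<phi>h[of v] hF[OF 2, of "Z x"] by (simp add: p_def)
      qed (use \<phi>p in auto)
    qed
    moreover have "cmod (\<phi> a - \<phi> b) \<le> l a b" if ab: "(a, b) \<in> Kb" for a b
    proof -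
      consider j where "j < k" "a = j" "b = k + j" | f where "f \<in> H" "a = J f" "b = 2 * k + 1"
        using ab by (auto simp: Kb_def)
      then show ?thesis
      proof cases
        case 1
        then show ?thesis
          using \<phi>h[of j] \<phi>p[of "k + j"] e2(2)[OF Z2, of j] k by (simp add: l_def p_def)
      next
        case 2
        have fJ: "\<phi> (J f) = f (Z x)" using \<phi>J 2(1) by blast
        have "J f < k" using J(1) 2(1) by blast
        \<comment> \<open>Conversely, a real value between 0 and 1 lies in that disc; the upper
          bound comes from the base position 0 of \<open>J f\<close> and
          \<open>\<delta> < 1\<close>.\<close>
        then have "cmod (f (Z x)) < 1"
          using e2(2)[OF Z2, of "J f"] \<phi>h[of "J f"] fJ hJ0[OF 2(1)] \<delta>(4) by simp
        moreover obtain t where t: "f (Z x) = of_real t"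
          using HR[OF 2(1), of \<epsilon> x] unfolding Z_def by (rule Reals_cases)
        moreover have "t \<ge> 0"
          using HX[OF \<epsilon>(1), of x] x(1) XT 2(1) t by (force simp: Z_def)
        moreover have "cmod (of_real t - 1) = \<bar>t - 1\<bar>"
          using norm_of_real[of "t - 1", where 'a=complex] by simp
        ultimately have "cmod (f (Z x) - 1) \<le> 1"
          by simp
        moreover have "\<phi> (2 * k + 1) = 1" using \<phi>p[of "2 * k + 1"] k by (simp add: p_def)
        ultimately show ?thesis using 2 fJ by (simp add: l_def)
      qed
    qed
    moreover have "cmod (\<phi> a - \<phi> b) = l a b" if ab: "(a, b) \<in> Rd" for a b
    proof -
      consider "(a, b) \<in> E" | i where "i < n" "a = J (w i)" "b = 2 * k"
        using ab by (auto simp: Rd_def)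
      then show ?thesis
      proof cases
        case 1
        then show ?thesis using E[OF 1] e2(3)[OF Z2 1] by (simp add: \<phi>h l_def)
      next
        case 2
        have "\<phi> (J (w i)) = w i (Z x)" using \<phi>J 2(1) by blast
        moreover have "Z x i \<noteq> - \<i>"
          using Zs[rule_format, of i] \<eta>(4) 2(1) by auto
        moreover have "Im (Z x i) = 0" using 2(1) by (simp add: Z_def scaled_point_def)
        ultimately have "cmod (\<phi> (J (w i))) = 1"
          using norm_inversion_line[of "Z x i"] by (simp add: w_def)
        moreover have "\<phi> (2 * k) = 0" using \<phi>p[of "2 * k"] k by (simp add: p_def)
        ultimately show ?thesis using 2 by (simp add: l_def)
      qed
    qed
    moreover have "\<phi> \<in> V \<rightarrow>\<^sub>E UNIV" by (simp add: x(2) \<Phi>_def)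
    ultimately show "\<phi> \<in> config_space L"
      unfolding config by blast
  qed
  moreover have "\<exists>f. polynomial_map (V <+> V) {..<n} f \<and>
    analytic_isomorphism (V <+> V) (real_coords V ` \<Phi> ` X) {..<n} X f"
  proof (rule analytic_isomorphism_of_parametrization[OF _ _ oU XU])
    show "{..<n} \<subseteq> V" using k by (auto simp: V_def)
    show "\<epsilon> \<noteq> 0" using \<epsilon>(1) by simp
    show "\<Phi> x \<in> V \<rightarrow>\<^sub>E UNIV" for x by (simp add: \<Phi>_def)
    show "Re (\<Phi> x i) = \<epsilon> * x i" if "i < n" for x i
      using that k inp[of i] by (simp add: \<Phi>_def V_def Z_def scaled_point_def)
    fix v assume v: "v \<in> V"
    show "admissible_complex {..<n} U (\<lambda>x. \<Phi> x v)"
    proof (cases "v < k")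
      case True
      have "admissible_complex {..<n} U (\<lambda>x. Z x i)" for i
      proof (cases "i < n")
        case i: True
        have "admissible_real {..<n} U (\<lambda>x. \<epsilon> * x i)"
          by (intro admissible_real_mult admissible_real_const admissible_real_coord) (use i in auto)
        then show ?thesis using i by (simp add: Z_def scaled_point_def admissible_complex_def admissible_real_const)
      qed (simp add: Z_def scaled_point_def admissible_complex_const)
      moreover have "cmod (Z x i) < e1 v" if "x \<in> U" for x i
        using Zsmall[OF that, of i] \<eta>(5)[OF True] by simp
      ultimately have "admissible_complex {..<n} U (\<lambda>x. h v (Z x))"
        using e1(2)[OF True] unfolding preserves_def by blast
      then show ?thesis using True v by (simp add: \<Phi>_def)
    qed (use v in \<open>simp add: \<Phi>_def admissible_complex_const\<close>)
  qed
  ultimately show ?thesis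
    by (intro exI[of _ L]) (simp add: L)
qed

end
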